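(* Let $m\ge n$, let $k,p\ge1$ be integers with $k+p\le n$, let $q\ge0$ be an integer, and let $A\in\mathbb{R}^{m\times n}$ have singular values $\sigma_1\ge\sigma_2\ge\cdots\ge\sigma_n$. Let $G$ be an $n\times(k+p)$ matrix with i.i.d. $\mathcal{N}(0,1)$ entries, set $H=(AA^* )^qAG$, and let the columns of $Q$ form an orthonormal basis of the range of $H$. Let $X_1$ and $X_2$ be respectively $(n-k)\times k$ and $(n-k)\times p$ random matrices with i.i.d. $\mathcal{N}(0,1)$ entries, let $\Sigma$ be a $k\times k$ diagonal random matrix whose diagonal entries are the singular values of a $(k+p)\times k$ matrix with i.i.d. $\mathcal{N}(0,1)$ entries, with $X_1,X_2,\Sigma$ independent (and independent of $G$), and define $$W = \bigl\| f(I_{n-k},X_2)\,\begin{bmatrix} X_1\Sigma^{-1} & I_{n-k}\end{bmatrix} \bigr\|.$$ Then $$\|(I-QQ^* )A\| \;\le_d\; \sigma_{k+1}\,W^{1/(2q+1)}.$$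
   Context: For a real $r\times s$ matrix $B$ and a real matrix $F$ with $s$ rows, $f(B,F) := (I-P)B$, where $P$ is the orthogonal projector onto the range (column space) of $BF$. $QQ^*$ is the orthogonal projector onto the range of $H$. $\|\cdot\|$ is the spectral norm and $I_r$ is the $r\times r$ identity matrix. For real random variables $X,Y$, $Y\le_d X$ means $\mathbb{P}(X\ge t)\ge\mathbb{P}(Y\ge t)$ for all $t\in\mathbb{R}$. *)

theory Defs
  imports "HOL-Probability.Probability"
begin

text \<open>
  Matrices are elements of \<open>real ^ 'c ^ 'r\<close> (rows indexed by \<open>'r\<close>, columns by \<open>'c\<close>), multiplied
  with \<open>**\<close>. On this type \<open>*\<close> and \<open>^\<close> act entrywise and \<open>norm\<close> is the Frobenius norm, so
  powers and the spectral norm are introduced separately.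
\<close>

definition mat_power :: "real ^ 'n ^ 'n \<Rightarrow> nat \<Rightarrow> real ^ 'n ^ 'n" where
  "mat_power B q = (((**) B) ^^ q) (mat 1)"

definition spectral_norm :: "real ^ 'c ^ 'r \<Rightarrow> real" where
  "spectral_norm B = onorm ((*v) B)"

definition mat_range :: "real ^ 'c ^ 'r \<Rightarrow> (real ^ 'r) set" where
  "mat_range B = range ((*v) B)"

definition hcat :: "real ^ 'a ^ 'r \<Rightarrow> real ^ 'b ^ 'r \<Rightarrow> real ^ ('a + 'b) ^ 'r" where
  "hcat B C = (\<chi> i j. case j of Inl a \<Rightarrow> B $ i $ a | Inr b \<Rightarrow> C $ i $ b)"

definition diagonal_matrix :: "real ^ 'n ^ 'n \<Rightarrow> bool" where
  "diagonal_matrix D \<longleftrightarrow> (\<forall>i j. i \<noteq> j \<longrightarrow> D $ i $ j = 0)"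

text \<open>
  The singular values of \<open>B\<close> (which has at least as many rows as columns wherever this is used)
  are the nonnegative square roots of the eigenvalues of \<open>transpose B ** B\<close>, repeated according to
  multiplicity. As that matrix is symmetric, the multiplicity is the dimension of the
  eigenspace. The enumeration \<open>s\<close> over the index set \<open>I\<close> is in no particular order;
  ordering is a separate hypothesis.
\<close>

definition has_singular_values :: "real ^ 'c ^ 'r \<Rightarrow> 'i set \<Rightarrow> ('i \<Rightarrow> real) \<Rightarrow> bool" where
  "has_singular_values B I s \<longleftrightarrow>
     finite I \<and> (\<forall>i\<in>I. 0 \<le> s i) \<and>
     (\<forall>t\<ge>0. card {i\<in>I. s i = t} = dim {v. (transpose B ** B) *v v = t\<^sup>2 *\<^sub>R v})"

definition orth_projector :: "(real ^ 'r) set \<Rightarrow> real ^ 'r ^ 'r" where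
  "orth_projector S = (THE P. \<forall>x. P *v x \<in> S \<and> (\<forall>y\<in>S. orthogonal (x - P *v x) y))"

lemma orth_projector_ex1:
  fixes S :: "(real ^ 'r) set"
  assumes S: "subspace S"
  shows "\<exists>!P :: real ^ 'r ^ 'r. \<forall>x. P *v x \<in> S \<and> (\<forall>y\<in>S. orthogonal (x - P *v x) y)"
proof -
  have uniq: "a = b"
    if "a \<in> S" "b \<in> S" "\<forall>y\<in>S. orthogonal (x - a) y" "\<forall>y\<in>S. orthogonal (x - b) y" for a b x
  proof -
    have d: "a - b \<in> S" using S that by (simp add: subspace_diff)
    have "(x - a) \<bullet> (a - b) = 0" "(x - b) \<bullet> (a - b) = 0"
      using that d by (auto simp: orthogonal_def)
    then have "(a - b) \<bullet> (a - b) = 0" by (simp add: inner_diff_left)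
    then show ?thesis by simp
  qed
  have "\<exists>y\<in>S. \<forall>w\<in>S. orthogonal (x - y) w" for x
  proof -
    obtain y z where "y \<in> span S" "\<And>w. w \<in> span S \<Longrightarrow> orthogonal z w" "x = y + z"
      using orthogonal_subspace_decomp_exists[of S x] by blast
    moreover have "span S = S" using S by (simp add: span_eq_iff)
    ultimately show ?thesis by (intro bexI[of _ y]) auto
  qed
  then obtain p where p: "\<And>x. p x \<in> S" "\<And>x w. w \<in> S \<Longrightarrow> orthogonal (x - p x) w" by metis
  have "linear p"
  proof (rule linearI)
    fix x y :: "real ^ 'r" and c :: real
    have "(x + y - (p x + p y)) \<bullet> w = 0" if "w \<in> S" for w
      using p(2)[OF that, of x] p(2)[OF that, of y]
      by (simp add: orthogonal_def inner_diff_left inner_add_left)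
    then show "p (x + y) = p x + p y"
      by (intro uniq[of _ _ "x + y"]) (auto simp: p S subspace_add orthogonal_def[symmetric])
    have "(c *\<^sub>R x - c *\<^sub>R p x) \<bullet> w = 0" if "w \<in> S" for w
      using p(2)[OF that, of x] by (simp add: orthogonal_def inner_diff_left)
    then show "p (c *\<^sub>R x) = c *\<^sub>R p x"
      by (intro uniq[of _ _ "c *\<^sub>R x"]) (auto simp: p S subspace_scale orthogonal_def[symmetric])
  qed
  then have mp: "matrix p *v x = p x" for x by (simp add: matrix_works)
  show ?thesis
  proof (rule ex1I[of _ "matrix p"])
    show "\<forall>x. matrix p *v x \<in> S \<and> (\<forall>y\<in>S. orthogonal (x - matrix p *v x) y)"
      using p by (simp add: mp)
  next
    fix P :: "real ^ 'r ^ 'r"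
    assume P: "\<forall>x. P *v x \<in> S \<and> (\<forall>y\<in>S. orthogonal (x - P *v x) y)"
    have "P *v x = matrix p *v x" for x
      using P p by (intro uniq[of _ _ x]) (auto simp: mp)
    then show "P = matrix p" by (simp add: matrix_eq)
  qed
qed

text \<open>The function \<open>f(B, F) = (I - P) B\<close>, where \<open>P\<close> projects orthogonally onto the range of \<open>B F\<close>.\<close>

definition proj_residual :: "real ^ 's ^ 'r \<Rightarrow> real ^ 't ^ 's \<Rightarrow> real ^ 's ^ 'r" where
  "proj_residual B F = (mat 1 - orth_projector (mat_range (B ** F))) ** B"

text \<open>
  The number of columns of the random matrix \<open>Q\<close> is the (random) rank of \<open>H\<close>, hence \<open>Q\<close> is
  represented by its set of columns, and \<open>Q Q\<^sup>T\<close> is the sum of \<open>u u\<^sup>T\<close> over the columns \<open>u\<close>.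
\<close>

definition orthonormal_basis :: "(real ^ 'r) set \<Rightarrow> (real ^ 'r) set \<Rightarrow> bool" where
  "orthonormal_basis Q S \<longleftrightarrow>
     pairwise orthogonal Q \<and> (\<forall>u\<in>Q. norm u = 1) \<and> span Q = S"

definition gram_outer :: "(real ^ 'r) set \<Rightarrow> real ^ 'r ^ 'r" where
  "gram_outer Q = (\<Sum>u\<in>Q. \<chi> i j. u $ i * u $ j)"

lemma gram_outer_eq_orth_projector:
  fixes Q S :: "(real ^ 'r) set"
  assumes "orthonormal_basis Q S"
  shows "gram_outer Q = orth_projector S"
proof -
  have orth: "pairwise orthogonal Q" and unit: "\<And>u. u \<in> Q \<Longrightarrow> norm u = 1" and span: "span Q = S"
    using assms by (auto simp: orthonormal_basis_def)
  have fin: "finite Q" using orth by (rule pairwise_orthogonal_imp_finite)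
  have S: "subspace S" using span by (metis subspace_span)
  have ap: "gram_outer Q *v x = (\<Sum>u\<in>Q. (u \<bullet> x) *\<^sub>R u)" for x
  proof -
    have "(gram_outer Q *v x) $ i = (\<Sum>u\<in>Q. (u \<bullet> x) *\<^sub>R u) $ i" for i
    proof -
      have "(gram_outer Q *v x) $ i = (\<Sum>j\<in>UNIV. \<Sum>u\<in>Q. u $ i * u $ j * x $ j)"
        by (simp add: gram_outer_def matrix_vector_mult_def sum_distrib_right)
      also have "\<dots> = (\<Sum>u\<in>Q. \<Sum>j\<in>UNIV. u $ i * u $ j * x $ j)"
        by (rule sum.swap)
      also have "\<dots> = (\<Sum>u\<in>Q. (\<Sum>j\<in>UNIV. u $ j * x $ j) * u $ i)"
        unfolding sum_distrib_right by (intro sum.cong refl) (simp add: mult.commute mult.left_commute)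
      also have "\<dots> = (\<Sum>u\<in>Q. (u \<bullet> x) *\<^sub>R u) $ i"
        by (simp add: inner_vec_def)
      finally show ?thesis .
    qed
    then show ?thesis by (simp add: vec_eq_iff)
  qed
  have "gram_outer Q *v x \<in> S \<and> (\<forall>y\<in>S. orthogonal (x - gram_outer Q *v x) y)" for x
  proof (intro conjI ballI)
    show "gram_outer Q *v x \<in> S"
      unfolding ap span[symmetric] by (intro span_sum span_scale span_base)
  next
    fix y assume "y \<in> S"
    have "orthogonal (x - gram_outer Q *v x) w" if w: "w \<in> Q" for w
    proof -
      have "(\<Sum>u\<in>Q. (u \<bullet> x) * (u \<bullet> w)) = (\<Sum>u\<in>Q. if u = w then w \<bullet> x else 0)"
      proof (rule sum.cong[OF refl])
        fix u assume u: "u \<in> Q"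
        show "(u \<bullet> x) * (u \<bullet> w) = (if u = w then w \<bullet> x else 0)"
          using orth unit[OF w] u w
          by (auto simp: pairwise_def orthogonal_def dot_square_norm)
      qed
      then show ?thesis
        using fin w
        by (simp add: orthogonal_def ap inner_diff_left inner_sum_left inner_commute[of x])
    qed
    then show "orthogonal (x - gram_outer Q *v x) y"
      using \<open>y \<in> S\<close> span orthogonal_to_span by blast
  qed
  then have "orth_projector S = gram_outer Q"
    unfolding orth_projector_def by (intro the1_equality[OF orth_projector_ex1[OF S]] allI)
  then show ?thesis by (rule sym)
qed

definition iid_std_normal :: "'w measure \<Rightarrow> ('w \<Rightarrow> real ^ 'c ^ 'r) \<Rightarrow> bool" where
  "iid_std_normal M X \<longleftrightarrow>
     prob_space.indep_vars M (\<lambda>_. borel) (\<lambda>(i, j) \<omega>. X \<omega> $ i $ j) UNIV \<and>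
     (\<forall>i j. distributed M lborel (\<lambda>\<omega>. X \<omega> $ i $ j) std_normal_density)"

text \<open>
  The preimages of Borel sets under a random variable. The library predicate \<open>indep_vars\<close> covers only
  random variables of one common value type, so joint independence of matrices of different
  shapes is expressed by \<open>indep_sets\<close> of these families (which includes measurability).
\<close>

definition rv_sets :: "'w measure \<Rightarrow> ('w \<Rightarrow> 'b::topological_space) \<Rightarrow> 'w set set" where
  "rv_sets M X = {X -` A \<inter> space M | A. A \<in> sets borel}"

text \<open>
  The order \<open>Y \<le>\<^sub>d X\<close>. That both sides are random variables is part of the definition, because
  \<open>measure\<close> is 0 on non-measurable sets.
\<close>

definition stoch_le :: "'w measure \<Rightarrow> ('w \<Rightarrow> real) \<Rightarrow> ('w \<Rightarrow> real) \<Rightarrow> bool" where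
  "stoch_le M Y X \<longleftrightarrow>
     Y \<in> borel_measurable M \<and> X \<in> borel_measurable M \<and>
     (\<forall>t. measure M {\<omega>\<in>space M. X \<omega> \<ge> t} \<ge> measure M {\<omega>\<in>space M. Y \<omega> \<ge> t})"

end

theory Submission
  imports Defs
begin

text \<open>
  Let \<open>B = (A A\<^sup>T)\<^sup>q A\<close>, let \<open>P\<close> project onto the range of \<open>B G\<close>, and let \<open>V = [V1 V2]\<close> be right
  singular vectors of \<open>A\<close>, \<open>V1\<close> belonging to the \<open>k\<close> largest singular values. Log-convexity of
  moments gives \<open>\<parallel>(I - P) A\<parallel>\<^sup>2\<^sup>q\<^sup>+\<^sup>1 \<le> \<parallel>(I - P) B\<parallel>\<close>. The norm \<open>\<parallel>(I - P) B x\<parallel>\<close> is a distance, hence at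
  most \<open>\<parallel>B (x - G z)\<parallel>\<close> for every \<open>z\<close>, and on the range of \<open>V2\<close> the norm of \<open>B\<close> is at most
  \<open>\<sigma>\<^sub>k\<^sub>+\<^sub>1\<close> to the power \<open>2 q + 1\<close>. Writing \<open>y = (V1\<^sup>T G)\<^sup>T\<close> with singular value decomposition
  \<open>y\<^sup>T [U1 U2] = [R S 0]\<close> and \<open>[x1 x2] = V2\<^sup>T G [U1 U2]\<close>, a suitable \<open>z\<close> bounds \<open>\<parallel>(I - P) B\<parallel>\<close> by this
  power times \<open>\<parallel>(I - P\<^sub>x\<^sub>2) [x1 S\<^sup>-\<^sup>1, I]\<parallel>\<close>.

  For Gaussian \<open>G\<close> the pair \<open>y\<close>, \<open>V2\<^sup>T G\<close> is Gaussian with independent components, by rotation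
  invariance; for fixed \<open>y\<close> the matrices \<open>x1\<close>, \<open>x2\<close> are again independent and Gaussian. Since \<open>y\<close> has
  the law of \<open>Y\<close>, integrating over \<open>y\<close> is the same as integrating over \<open>Y \<omega>\<close>, whose singular
  values are supplied by \<open>\<Sigma> \<omega>\<close>.
\<close>

section \<open>Residual projections and spectral norms\<close>

text \<open>As a simp rule it turns \<open>transpose B *v x\<close> into \<open>x v* B\<close>, and
  the adjoint rules below would no longer match.\<close>

declare transpose_matrix_vector [simp del]

lemma inner_transpose_mult:
  fixes B :: "real ^ 'c ^ 'r"
  shows "(transpose B *v x) \<bullet> y = x \<bullet> (B *v y)" "(B *v y) \<bullet> x = y \<bullet> (transpose B *v x)"
  by (simp_all add: transpose_matrix_vector dot_lmul_matrix[symmetric] inner_commute)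

lemma norm_mult_le_spectral_norm:
  "norm (B *v x) \<le> spectral_norm B * norm x"
  unfolding spectral_norm_def by (rule onorm[OF matrix_vector_mul_bounded_linear])

lemma spectral_norm_nonneg: "0 \<le> spectral_norm B"
  unfolding spectral_norm_def by (rule onorm_pos_le[OF matrix_vector_mul_bounded_linear])

lemma spectral_norm_leI:
  "(\<And>x. norm (B *v x) \<le> b * norm x) \<Longrightarrow> spectral_norm B \<le> b"
  unfolding spectral_norm_def by (rule onorm_le)

text \<open>Cauchy-Schwarz bounds the square of \<open>norm (transpose B *v x)\<close>, which is the
  inner product of \<open>x\<close> and \<open>B *v (transpose B *v x)\<close>; one factor then
  cancels.\<close>

lemma spectral_norm_transpose_le:
  fixes B :: "real ^ 'c ^ 'r"
  shows "spectral_norm (transpose B) \<le> spectral_norm B"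
proof (rule spectral_norm_leI)
  fix x
  have "norm (transpose B *v x) * norm (transpose B *v x) = x \<bullet> (B *v (transpose B *v x))"
    by (metis inner_transpose_mult(1) norm_eq_sqrt_inner real_sqrt_mult_self abs_of_nonneg inner_ge_zero)
  also have "\<dots> \<le> norm x * (spectral_norm B * norm (transpose B *v x))"
    by (meson norm_cauchy_schwarz order_trans mult_left_mono norm_ge_zero norm_mult_le_spectral_norm)
  finally have "norm (transpose B *v x) * norm (transpose B *v x) \<le>
      (spectral_norm B * norm x) * norm (transpose B *v x)"
    by (simp add: mult_ac)
  then show "norm (transpose B *v x) \<le> spectral_norm B * norm x"
    by (cases "norm (transpose B *v x) = 0")
      (auto simp: spectral_norm_nonneg dest: mult_right_le_imp_le)
qed

lemma spectral_norm_transpose: "spectral_norm (transpose B) = spectral_norm B"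
  using spectral_norm_transpose_le[of B] spectral_norm_transpose_le[of "transpose B"]
  by (simp add: transpose_transpose)

lemma subspace_mat_range: "subspace (mat_range B)"
  unfolding mat_range_def
  by (rule linear_subspace_image[OF matrix_vector_mul_linear subspace_UNIV])

lemma
  assumes "subspace S"
  shows orth_projector_in: "orth_projector S *v x \<in> S"
    and orth_projector_orthogonal: "y \<in> S \<Longrightarrow> (x - orth_projector S *v x) \<bullet> y = 0"
  using theI'[OF orth_projector_ex1[OF assms]]
  unfolding orth_projector_def[symmetric] by (auto simp: orthogonal_def)

abbreviation residual :: "real ^ 'c ^ 'r \<Rightarrow> real ^ 'r ^ 'r" where
  "residual B \<equiv> mat 1 - orth_projector (mat_range B)"

lemma residual_mult: "residual B *v x = x - orth_projector (mat_range B) *v x"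
  by (simp add: matrix_vector_mult_diff_rdistrib)

lemma residual_orthogonal: "(residual B *v x) \<bullet> (B *v y) = 0"
  unfolding residual_mult
  by (rule orth_projector_orthogonal[OF subspace_mat_range]) (simp add: mat_range_def)

lemma residual_eq: "\<exists>y. residual B *v x = x - B *v y"
proof -
  have "orth_projector (mat_range B) *v x \<in> range ((*v) B)"
    using orth_projector_in[OF subspace_mat_range[of B], of x] by (simp add: mat_range_def)
  then obtain y where "orth_projector (mat_range B) *v x = B *v y" by (rule imageE)
  then show ?thesis by (auto simp: residual_mult intro: exI[of _ y])
qed

text \<open>Pythagoras, since \<open>x - B *v y\<close> differs from the residual by a vector in the
  range. Together with \<open>residual_eq\<close> this makes the norm of the residual the distance
  of \<open>x\<close> from the range, which serves both the estimates and measurability.\<close>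

lemma residual_le_dist: "norm (residual B *v x) \<le> norm (x - B *v y)"
proof -
  obtain z where z: "residual B *v x = x - B *v z"
    using residual_eq by blast
  have "x - B *v y = residual B *v x + B *v (z - y)"
    unfolding z by (simp add: matrix_vector_mult_diff_distrib)
  moreover have "orthogonal (residual B *v x) (B *v (z - y))"
    by (simp add: orthogonal_def residual_orthogonal)
  ultimately have "(norm (x - B *v y))\<^sup>2 = (norm (residual B *v x))\<^sup>2 + (norm (B *v (z - y)))\<^sup>2"
    by (simp add: norm_add_Pythagorean)
  then show ?thesis
    by (metis le_add_same_cancel1 norm_ge_zero power2_le_imp_le zero_le_power2)
qed

text \<open>\<open>y\<close> and its residual differ by a vector in the range, to which the residual
  of \<open>x\<close> is orthogonal. The identity encodes that \<open>I - P\<close> is symmetric and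
  idempotent.\<close>

lemma inner_residual: "(residual B *v x) \<bullet> y = (residual B *v x) \<bullet> (residual B *v y)"
proof -
  obtain z where "residual B *v y = y - B *v z"
    using residual_eq by blast
  then show ?thesis
    by (simp add: inner_diff_right residual_orthogonal)
qed

lemma transpose_residual: "transpose (residual B) = residual B"
proof -
  have "(residual B *v x) \<bullet> y = (transpose (residual B) *v x) \<bullet> y" for x y
    by (metis inner_commute inner_residual inner_transpose_mult(1))
  then show ?thesis
    by (metis matrix_eq vector_eq_rdot)
qed

section \<open>Matrix powers and log-convex moments\<close>

lemma mat_power_0: "mat_power C 0 = mat 1"
  and mat_power_Suc: "mat_power C (Suc i) = C ** mat_power C i"
  by (simp_all add: mat_power_def)

lemma mat_power_commute: "mat_power C i ** C = C ** mat_power C i"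
  by (induction i) (simp_all add: mat_power_0 mat_power_Suc matrix_mul_assoc[symmetric])

lemma transpose_mat_power: "transpose (mat_power C i) = mat_power (transpose C) i"
  by (induction i)
    (simp_all add: mat_power_0 mat_power_Suc matrix_transpose_mul mat_power_commute transpose_mat)

text \<open>The ratios \<open>a (Suc j) / a j\<close> are nondecreasing, so each is at least
  \<open>a 1 / a 0\<close>; multiplying them gives the claim. The inner claim is free of division
  because terms may vanish.\<close>

lemma log_convex_power_le:
  fixes a :: "nat \<Rightarrow> real"
  assumes nn: "\<And>j. 0 \<le> a j" and lc: "\<And>j. (a (Suc j))\<^sup>2 \<le> a j * a (Suc (Suc j))"
  shows "a 1 ^ Suc m \<le> a (Suc m) * a 0 ^ m"
proof (induction m)
  case (Suc m)
  have step: "a 1 * a j \<le> a 0 * a (Suc j)" for j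
  proof (induction j)
    case (Suc j)
    show ?case
    proof (cases "a j = 0")
      case True
      then have "a (Suc j) = 0" using lc[of j] by simp
      then show ?thesis using nn by simp
    next
      case False
      then have pos: "a j > 0" using nn[of j] by simp
      have "a j * (a 1 * a (Suc j)) = (a 1 * a j) * a (Suc j)" by simp
      also have "\<dots> \<le> (a 0 * a (Suc j)) * a (Suc j)"
        by (rule mult_right_mono[OF Suc nn])
      also have "\<dots> = a 0 * (a (Suc j))\<^sup>2" by (simp add: power2_eq_square)
      also have "\<dots> \<le> a 0 * (a j * a (Suc (Suc j)))"
        by (rule mult_left_mono[OF lc nn])
      also have "\<dots> = a j * (a 0 * a (Suc (Suc j)))" by simp
      finally show ?thesis using pos by simp
    qed
  qed simp
  have "a 1 ^ Suc (Suc m) \<le> a 1 * (a (Suc m) * a 0 ^ m)"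
    using mult_left_mono[OF Suc nn[of 1]] by simp
  also have "\<dots> = (a 1 * a (Suc m)) * a 0 ^ m" by simp
  also have "\<dots> \<le> (a 0 * a (Suc (Suc m))) * a 0 ^ m"
    by (intro mult_right_mono step) (simp add: nn)
  finally show ?case by (simp add: mult_ac)
qed simp

text \<open>With \<open>C = A A\<^sup>T\<close>, the moments \<open>\<langle>C\<^sup>j u, u\<rangle>\<close> are log-convex in \<open>j\<close> by Cauchy-Schwarz.\<close>

lemma norm_transpose_power_le:
  fixes A :: "real ^ 'n ^ 'm"
  shows "norm (transpose A *v u) ^ (2 * q + 1) \<le>
    norm (transpose (mat_power (A ** transpose A) q ** A) *v u) * norm u ^ (2 * q)"
proof -
  define C where "C = A ** transpose A"
  define c where "c i = mat_power C i *v u" for i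
  have c0: "c 0 = u" and cS: "c (Suc i) = A *v (transpose A *v c i)" for i
    by (simp_all add: c_def mat_power_0 mat_power_Suc C_def matrix_vector_mul_assoc matrix_mul_assoc)
  \<comment> \<open>This is the inner product of \<open>C\<^sup>j u\<close> with \<open>u\<close>.
    For odd \<open>j\<close> one factor \<open>A ** transpose A\<close> is split between the two
    sides, which leaves the norm of a vector \<open>transpose A *v c i\<close>.\<close>
  define a where "a j = (if even j then (norm (c (j div 2)))\<^sup>2
    else (norm (transpose A *v c (j div 2)))\<^sup>2)" for j
  have "(a (Suc j))\<^sup>2 \<le> a j * a (Suc (Suc j))" for j
  proof (cases "even j")
    case True
    then obtain i where j: "j = 2 * i" by auto
    have "(norm (transpose A *v c i))\<^sup>2 = c i \<bullet> c (Suc i)"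
      by (simp add: cS power2_norm_eq_inner inner_transpose_mult)
    also have "\<dots> \<le> norm (c i) * norm (c (Suc i))" by (rule norm_cauchy_schwarz)
    finally have "((norm (transpose A *v c i))\<^sup>2)\<^sup>2 \<le> (norm (c i) * norm (c (Suc i)))\<^sup>2"
      by (rule power_mono) simp
    then show ?thesis using j by (simp add: a_def power_mult_distrib)
  next
    case False
    then obtain i where j: "j = 2 * i + 1" by (elim oddE)
    have "(norm (c (Suc i)))\<^sup>2 = (transpose A *v c i) \<bullet> (transpose A *v c (Suc i))"
      by (metis cS inner_transpose_mult(2) power2_norm_eq_inner)
    also have "\<dots> \<le> norm (transpose A *v c i) * norm (transpose A *v c (Suc i))"
      by (rule norm_cauchy_schwarz)
    finally have "((norm (c (Suc i)))\<^sup>2)\<^sup>2 \<le>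
        (norm (transpose A *v c i) * norm (transpose A *v c (Suc i)))\<^sup>2"
      by (rule power_mono) simp
    then show ?thesis using j by (simp add: a_def power_mult_distrib)
  qed
  then have "a 1 ^ Suc (2 * q) \<le> a (Suc (2 * q)) * a 0 ^ (2 * q)"
    by (intro log_convex_power_le) (auto simp: a_def)
  \<comment> \<open>All moments are squares, so taking roots returns to norms;
    \<open>2 * q + 1\<close> is the odd index at which \<open>a\<close> involves
    \<open>transpose A *v c q\<close>.\<close>
  then have "(norm (transpose A *v u) ^ (2 * q + 1))\<^sup>2 \<le>
      (norm (transpose A *v c q) * norm u ^ (2 * q))\<^sup>2"
    by (simp add: a_def c0 power_mult_distrib power_mult[symmetric] mult_ac)
  then have "norm (transpose A *v u) ^ (2 * q + 1) \<le> norm (transpose A *v c q) * norm u ^ (2 * q)"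
    by (rule power2_le_imp_le) simp
  moreover have "transpose C = C"
    by (simp add: C_def matrix_transpose_mul transpose_transpose)
  then have "transpose (mat_power C q ** A) *v u = transpose A *v c q"
    by (simp add: matrix_transpose_mul transpose_mat_power c_def matrix_vector_mul_assoc)
  ultimately show ?thesis by (simp add: C_def)
qed

text \<open>After transposition \<open>I - P\<close> acts first, as it is symmetric; the moment
  inequality applies to the residual of \<open>x\<close>, whose norm is at most that of
  \<open>x\<close>. The odd root then gives a bound linear in \<open>norm x\<close>, as an operator
  norm requires.\<close>

lemma residual_power_le:
  fixes A :: "real ^ 'n ^ 'm" and F :: "real ^ 'c ^ 'm"
  shows "spectral_norm (residual F ** A) ^ (2 * q + 1) \<le>
    spectral_norm (residual F ** (mat_power (A ** transpose A) q ** A))"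
proof -
  define B where "B = mat_power (A ** transpose A) q ** A"
  define \<beta> where "\<beta> = spectral_norm (residual F ** B)"
  have nn: "\<beta> \<ge> 0" by (simp add: \<beta>_def spectral_norm_nonneg)
  have tr: "transpose (residual F ** D) *v x = transpose D *v (residual F *v x)"
    for D :: "real ^ 'n ^ 'm" and x
    by (simp add: matrix_transpose_mul transpose_residual matrix_vector_mul_assoc)
  have "spectral_norm (transpose (residual F ** A)) \<le> root (2 * q + 1) \<beta>"
  proof (rule spectral_norm_leI)
    fix x
    let ?u = "residual F *v x"
    have u: "norm ?u \<le> norm x" using residual_le_dist[of F x 0] by simp
    have "norm (transpose A *v ?u) ^ (2 * q + 1) \<le> norm (transpose B *v ?u) * norm ?u ^ (2 * q)"
      unfolding B_def by (rule norm_transpose_power_le)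
    also have "\<dots> \<le> (\<beta> * norm x) * norm x ^ (2 * q)"
      using norm_mult_le_spectral_norm[of "transpose (residual F ** B)" x] u nn
      by (intro mult_mono power_mono) (auto simp: tr spectral_norm_transpose \<beta>_def spectral_norm_nonneg)
    also have "\<dots> = (root (2 * q + 1) \<beta> * norm x) ^ (2 * q + 1)"
      using nn by (simp add: power_mult_distrib real_root_pow_pos2 del: power_Suc) simp
    finally show "norm (transpose (residual F ** A) *v x) \<le> root (2 * q + 1) \<beta> * norm x"
      unfolding tr using nn by (subst (asm) power_mono_iff) auto
  qed
  then have "spectral_norm (residual F ** A) ^ (2 * q + 1) \<le> root (2 * q + 1) \<beta> ^ (2 * q + 1)"
    by (intro power_mono) (simp_all add: spectral_norm_transpose spectral_norm_nonneg)
  then show ?thesis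
    using nn by (simp add: real_root_pow_pos2 \<beta>_def B_def del: power_Suc)
qed

section \<open>Singular vectors and orthogonal blocks\<close>

text \<open>The definition of singular values only counts multiplicities, so an orthonormal basis of
  each eigenspace is matched with the indices carrying that value. Different eigenspaces are
  orthogonal because \<open>transpose B ** B\<close> is symmetric.\<close>

lemma singular_vectors_exist:
  fixes B :: "real ^ 'c ^ 'r"
  assumes "has_singular_values B I s"
  obtains v where "\<And>i. i \<in> I \<Longrightarrow> (transpose B ** B) *v v i = (s i)\<^sup>2 *\<^sub>R v i"
    and "\<And>i j. i \<in> I \<Longrightarrow> j \<in> I \<Longrightarrow> v i \<bullet> v j = (if i = j then 1 else 0)"
proof -
  define C where "C = transpose B ** B"
  define E where "E t = {v. C *v v = t\<^sup>2 *\<^sub>R v}" for t :: real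
  have fin: "finite I" and nn: "\<And>i. i \<in> I \<Longrightarrow> 0 \<le> s i"
    and dim: "\<And>t. t \<ge> 0 \<Longrightarrow> card {i\<in>I. s i = t} = dim (E t)"
    using assms by (auto simp: has_singular_values_def C_def E_def)
  have sub: "subspace (E t)" for t
    by (auto simp: subspace_def E_def matrix_vector_right_distrib scaleR_right_distrib
        matrix_vector_mult_scaleR mult.commute)
  define P where "P f t \<longleftrightarrow> inj_on f {i\<in>I. s i = t} \<and> f ` {i\<in>I. s i = t} \<subseteq> E t \<and>
      pairwise orthogonal (f ` {i\<in>I. s i = t}) \<and> (\<forall>u\<in>f ` {i\<in>I. s i = t}. norm u = 1)" for f t
  have "\<exists>f. P f t" if t: "t \<ge> 0" for t
  proof -
    obtain D where D: "D \<subseteq> E t" "pairwise orthogonal D" "\<And>x. x \<in> D \<Longrightarrow> norm x = 1"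
      "independent D" "card D = dim (E t)"
      using orthonormal_basis_subspace[OF sub[of t]] by metis
    then have "finite D" by (simp add: finiteI_independent)
    then obtain f where "bij_betw f {i\<in>I. s i = t} D"
      using finite_same_card_bij[of "{i\<in>I. s i = t}" D] fin D dim[OF t] by auto
    then show ?thesis
      unfolding P_def using D by (intro exI[of _ f]) (auto simp: bij_betw_def)
  qed
  then have "\<forall>t. \<exists>f. t \<ge> 0 \<longrightarrow> P f t" by blast
  then obtain F where "\<forall>t. t \<ge> 0 \<longrightarrow> P (F t) t" by (rule choice[THEN exE])
  then have f: "\<And>t. t \<ge> 0 \<Longrightarrow> inj_on (F t) {i\<in>I. s i = t}"
      "\<And>t. t \<ge> 0 \<Longrightarrow> F t ` {i\<in>I. s i = t} \<subseteq> E t"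
      "\<And>t. t \<ge> 0 \<Longrightarrow> pairwise orthogonal (F t ` {i\<in>I. s i = t})"
      "\<And>t. t \<ge> 0 \<Longrightarrow> \<forall>u\<in>F t ` {i\<in>I. s i = t}. norm u = 1"
    unfolding P_def by blast+
  define v where "v i = F (s i) i" for i
  have eig: "C *v v i = (s i)\<^sup>2 *\<^sub>R v i" if "i \<in> I" for i
    using f(2)[OF nn[OF that]] that by (auto simp: v_def E_def)
  have "v i \<bullet> v j = (if i = j then 1 else 0)" if ij: "i \<in> I" "j \<in> I" for i j
  proof (cases "s i = s j")
    case True
    have m: "v i \<in> F (s i) ` {l\<in>I. s l = s i}" "v j \<in> F (s i) ` {l\<in>I. s l = s i}"
      using ij True by (auto simp: v_def)
    show ?thesis
    proof (cases "i = j")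
      case True
      have "norm (v i) = 1" using f(4)[OF nn[OF ij(1)]] m by blast
      then show ?thesis using True by (simp add: dot_square_norm)
    next
      case False
      then have "v i \<noteq> v j"
        using f(1)[OF nn[OF ij(1)]] ij True by (auto simp: v_def inj_on_def)
      then have "orthogonal (v i) (v j)"
        using f(3)[OF nn[OF ij(1)]] m unfolding pairwise_def by blast
      then show ?thesis using False by (simp add: orthogonal_def)
    qed
  next
    case False
    have "transpose C = C" by (simp add: C_def matrix_transpose_mul transpose_transpose)
    then have "(C *v v i) \<bullet> v j = v i \<bullet> (C *v v j)"
      by (metis inner_transpose_mult(1))
    then have "((s i)\<^sup>2 - (s j)\<^sup>2) * (v i \<bullet> v j) = 0"
      by (simp add: eig ij algebra_simps)
    \<comment> \<open>Nonnegativity rules out \<open>s i = - s j\<close>.\<close>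
    moreover have "(s i)\<^sup>2 \<noteq> (s j)\<^sup>2" using False nn ij by (simp add: power2_eq_iff_nonneg)
    ultimately show ?thesis using False by auto
  qed
  with eig show ?thesis unfolding C_def by (rule that)
qed

text \<open>The matrix \<open>[V1 V2]\<close> is orthogonal. \<open>hcat V1 V2\<close> has columns
  indexed by \<open>'a + 'b\<close> and rows by \<open>'n\<close>, so its orthogonality is stated
  block by block.\<close>

definition block_orthogonal :: "real ^ 'a ^ 'n \<Rightarrow> real ^ 'b ^ 'n \<Rightarrow> bool" where
  "block_orthogonal V1 V2 \<longleftrightarrow>
     transpose V1 ** V1 = mat 1 \<and> transpose V2 ** V2 = mat 1 \<and>
     transpose V1 ** V2 = 0 \<and> transpose V2 ** V1 = 0 \<and>
     V1 ** transpose V1 + V2 ** transpose V2 = mat 1"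

lemma norm_block_orthogonal:
  assumes "block_orthogonal V1 V2"
  shows "(norm (V1 *v a + V2 *v b))\<^sup>2 = (norm a)\<^sup>2 + (norm b)\<^sup>2"
proof -
  have "(V1 *v a) \<bullet> (V1 *v a) = a \<bullet> a" "(V2 *v b) \<bullet> (V2 *v b) = b \<bullet> b" "(V1 *v a) \<bullet> (V2 *v b) = 0"
    using assms
    by (simp_all add: inner_transpose_mult(2) matrix_vector_mul_assoc block_orthogonal_def)
  then show ?thesis
    by (simp add: power2_norm_eq_inner inner_add_left inner_add_right inner_commute[of "V2 *v b" "V1 *v a"])
qed

lemma norm_transpose_block_orthogonal:
  assumes "block_orthogonal V1 V2"
  shows "(norm (transpose V1 *v x))\<^sup>2 + (norm (transpose V2 *v x))\<^sup>2 = (norm x)\<^sup>2"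
proof -
  have "V1 *v (transpose V1 *v x) + V2 *v (transpose V2 *v x) =
      (V1 ** transpose V1 + V2 ** transpose V2) *v x"
    by (simp add: matrix_vector_mult_add_rdistrib matrix_vector_mul_assoc)
  then show ?thesis
    using norm_block_orthogonal[OF assms, of "transpose V1 *v x" "transpose V2 *v x"] assms
    by (simp add: block_orthogonal_def)
qed

lemma norm_mat_columns:
  fixes X :: "real ^ 'c ^ 'r"
  shows "(norm X)\<^sup>2 = (\<Sum>j\<in>UNIV. (norm (column j X))\<^sup>2)"
proof -
  have "(norm X)\<^sup>2 = (\<Sum>i\<in>UNIV. \<Sum>j\<in>UNIV. X $ i $ j * X $ i $ j)"
    by (simp add: power2_norm_eq_inner inner_vec_def)
  also have "\<dots> = (\<Sum>j\<in>UNIV. \<Sum>i\<in>UNIV. X $ i $ j * X $ i $ j)" by (rule sum.swap)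
  finally show ?thesis
    by (simp add: power2_norm_eq_inner inner_vec_def column_def)
qed

lemma column_mult: "column j (B ** X) = B *v column j X"
  by (simp add: vec_eq_iff column_def matrix_matrix_mult_def matrix_vector_mult_def)

lemma norm_transpose: "norm (transpose X) = norm (X :: real ^ 'c ^ 'r)"
proof -
  have "(norm (transpose X))\<^sup>2 = (norm X)\<^sup>2"
    unfolding power2_norm_eq_inner inner_vec_def
    by (simp add: transpose_def) (rule sum.swap)
  then show ?thesis by simp
qed

lemma matrix_mult_scaleR:
  "B ** (c *\<^sub>R X) = c *\<^sub>R (B ** (X :: real ^ 'c ^ 'r))"
  by (simp add: vec_eq_iff matrix_matrix_mult_def sum_distrib_left mult_ac)

lemma matrix_add_rdistrib: "(B + C) ** X = B ** X + C ** (X :: real ^ 'c ^ 'r)"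
  by (simp add: vec_eq_iff matrix_matrix_mult_def sum.distrib distrib_right)

text \<open>Squared Frobenius norms add up over columns, which reduces the isometry to vectors; the
  transposed blocks supply preimages. This is the rotation applied later to Gaussian
  matrices.\<close>

lemma block_orthogonal_isometry:
  fixes V1 :: "real ^ 'a ^ 'n" and V2 :: "real ^ 'b ^ 'n"
  assumes "block_orthogonal V1 V2"
  defines "T \<equiv> \<lambda>(X, Y). V1 ** (X :: real ^ 'c ^ 'a) + V2 ** Y"
  shows "linear T" "\<And>z. norm (T z) = norm z" "surj T"
proof -
  show "linear T"
    by (auto intro!: linearI simp: T_def matrix_add_ldistrib scaleR_right_distrib matrix_mult_scaleR)
  show "norm (T z) = norm z" for z
  proof -
    obtain X Y where z: "z = (X, Y)" by force
    have "(norm (T z))\<^sup>2 = (norm X)\<^sup>2 + (norm Y)\<^sup>2"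
    proof -
      have "column j (T z) = V1 *v column j X + V2 *v column j Y" for j
        unfolding column_mult[symmetric] by (simp add: T_def z column_def vec_eq_iff)
      then show ?thesis
        by (simp add: norm_mat_columns norm_block_orthogonal[OF assms(1)] sum.distrib)
    qed
    then show ?thesis by (simp add: z norm_Pair real_sqrt_unique[symmetric])
  qed
  show "surj T"
  proof (rule surjI)
    fix Z
    show "T (transpose V1 ** Z, transpose V2 ** Z) = Z"
      using assms(1) by (simp add: T_def matrix_mul_assoc matrix_add_rdistrib[symmetric] block_orthogonal_def)
  qed
qed

section \<open>Orthonormal families as matrix blocks\<close>

lemma sum_UNIV_sum_type:
  fixes f :: "'a::finite + 'b::finite \<Rightarrow> 'c::comm_monoid_add"
  shows "(\<Sum>i\<in>UNIV. f i) = (\<Sum>i\<in>UNIV. f (Inl i)) + (\<Sum>j\<in>UNIV. f (Inr j))"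
  by (simp add: UNIV_Plus_UNIV[symmetric] sum.Plus del: UNIV_Plus_UNIV)

lemma matrix_of_columns:
  fixes v :: "'a::finite \<Rightarrow> real ^ 'n"
  shows "(\<chi> i j. v j $ i) *v b = (\<Sum>j\<in>UNIV. b $ j *\<^sub>R v j)"
  by (simp add: vec_eq_iff matrix_vector_mult_def mult.commute)

text \<open>By cardinality the family is a basis. The sum of \<open>V1 ** transpose V1\<close> and
  \<open>V2 ** transpose V2\<close> fixes each \<open>v j\<close>, hence every vector.\<close>

lemma block_orthogonalI:
  fixes v :: "'a::finite + 'b::finite \<Rightarrow> real ^ 'n"
  assumes on: "\<And>i j. v i \<bullet> v j = (if i = j then 1 else 0)"
    and card: "CARD('a) + CARD('b) = CARD('n)"
  shows "block_orthogonal (\<chi> i j. v (Inl j) $ i) (\<chi> i j. v (Inr j) $ i)"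
proof -
  define V1 V2 where "V1 = (\<chi> i j. v (Inl j) $ i)" and "V2 = (\<chi> i j. v (Inr j) $ i)"
  have "pairwise orthogonal (range v)" "0 \<notin> range v"
    using on by (auto simp: pairwise_def orthogonal_def) (metis inner_zero_left zero_neq_one)
  then have ind: "independent (range v)" by (rule pairwise_orthogonal_independent)
  have "inj v" using on by (metis injI zero_neq_one)
  then have "card (range v) = CARD('n)" by (simp add: card_image card)
  then have "dim (range v) = CARD('n)" using dim_eq_card_independent[OF ind] by simp
  then have span: "span (range v) = UNIV"
    using dim_eq_full[of "range v"] by simp
  have eq: "(V1 ** transpose V1 + V2 ** transpose V2) *v x = (\<Sum>i\<in>UNIV. (v i \<bullet> x) *\<^sub>R v i)" for x
  proof -
    have tr: "(transpose V1 *v x) $ j = v (Inl j) \<bullet> x" "(transpose V2 *v x) $ j' = v (Inr j') \<bullet> x" for j j'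
      by (simp_all add: V1_def V2_def transpose_def matrix_vector_mult_def inner_vec_def)
    have "V1 *v (transpose V1 *v x) = (\<Sum>j\<in>UNIV. (v (Inl j) \<bullet> x) *\<^sub>R v (Inl j))"
      by (subst V1_def) (simp only: matrix_of_columns tr)
    moreover have "V2 *v (transpose V2 *v x) = (\<Sum>j\<in>UNIV. (v (Inr j) \<bullet> x) *\<^sub>R v (Inr j))"
      by (subst V2_def) (simp only: matrix_of_columns tr)
    ultimately show ?thesis
      by (simp add: sum_UNIV_sum_type matrix_vector_mult_add_rdistrib matrix_vector_mul_assoc[symmetric])
  qed
  have *: "(V1 ** transpose V1 + V2 ** transpose V2) *v x = x" for x
  proof -
    have "x \<in> span (range v)" by (simp add: span)
    then show ?thesis
    proof (induction rule: span_induct_alt)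
      case (step c y z)
      then obtain j where y: "y = v j" by auto
      have "(\<Sum>i\<in>UNIV. (v i \<bullet> v j) *\<^sub>R v i) = v j"
        by (simp add: on if_distrib[of "\<lambda>c. c *\<^sub>R _"] cong: if_cong)
      then show ?case
        using step by (simp add: matrix_vector_right_distrib matrix_vector_mult_scaleR y eq[of "v j"])
    qed simp
  qed
  have "transpose V1 ** V1 = mat 1" "transpose V2 ** V2 = mat 1"
    "transpose V1 ** V2 = 0" "transpose V2 ** V1 = 0"
    using on by (auto simp: vec_eq_iff matrix_matrix_mult_def transpose_def V1_def V2_def inner_vec_def mat_def)
  moreover have "V1 ** transpose V1 + V2 ** transpose V2 = mat 1"
    using * by (simp add: matrix_eq)
  ultimately show ?thesis by (simp add: block_orthogonal_def V1_def V2_def)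
qed

text \<open>The orthogonal complement of the span of \<open>w\<close> has dimension
  \<open>CARD('b)\<close>; an orthonormal basis of it, indexed by \<open>'b\<close>, supplies the
  new vectors.\<close>

lemma orthonormal_extend:
  fixes w :: "'a::finite \<Rightarrow> real ^ 'd"
  assumes on: "\<And>i j. w i \<bullet> w j = (if i = j then 1 else 0)"
    and card: "CARD('a) + CARD('b::finite) = CARD('d)"
  obtains v :: "'a + 'b::finite \<Rightarrow> real ^ 'd"
  where "\<And>i. v (Inl i) = w i" "\<And>i j. v i \<bullet> v j = (if i = j then 1 else 0)"
proof -
  define L where "L = {y. \<forall>x\<in>span (range w). orthogonal x y}"
  have "pairwise orthogonal (range w)" "0 \<notin> range w"
    using on by (auto simp: pairwise_def orthogonal_def) (metis inner_zero_left zero_neq_one)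
  then have "independent (range w)" by (rule pairwise_orthogonal_independent)
  moreover have "inj w" using on by (metis injI zero_neq_one)
  ultimately have "dim (span (range w)) = CARD('a)"
    by (simp add: dim_eq_card_independent card_image)
  then have dim: "dim L = CARD('b)"
    using dim_subspace_orthogonal_to_vectors[of "span (range w)" "UNIV :: (real ^ 'd) set"] card
    by (simp add: L_def)
  have "subspace L"
    by (auto simp: subspace_def L_def orthogonal_clauses)
  then obtain D where D: "D \<subseteq> L" "pairwise orthogonal D" "\<And>x. x \<in> D \<Longrightarrow> norm x = 1"
      "independent D" "card D = dim L"
    using orthonormal_basis_subspace by metis
  then obtain f where f: "bij_betw f (UNIV :: 'b set) D"
    using finite_same_card_bij[of "UNIV :: 'b set" D] dim by (auto simp: finiteI_independent)
  then have fD: "f i \<in> D" for i by (auto simp: bij_betw_def)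
  have wf: "w i \<bullet> f j = 0" for i j
    using fD[of j] D(1) by (auto simp: L_def orthogonal_def span_base)
  have ff: "f i \<bullet> f j = (if i = j then 1 else 0)" for i j
  proof (cases "i = j")
    case True
    then show ?thesis using D(3)[OF fD[of i]] by (simp add: dot_square_norm)
  next
    case False
    then have "f i \<noteq> f j" using f by (auto simp: bij_betw_def inj_def)
    then show ?thesis using D(2) fD False by (auto simp: pairwise_def orthogonal_def)
  qed
  show ?thesis
  proof (rule that[of "case_sum w f"])
    show "case_sum w f i \<bullet> case_sum w f j = (if i = j then 1 else 0)" for i j
      using on ff wf by (auto split: sum.split simp: inner_commute[of "f _" "w _"])
  qed simp
qed

text \<open>\<open>A ** transpose A\<close> multiplies \<open>A *v v i\<close> by the square of
  \<open>s i\<close>, so its power contributes the factor \<open>s i ^ (2 * q)\<close>. The vectors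
  \<open>A *v v i\<close> are pairwise orthogonal of norm \<open>s i\<close>, and Pythagoras adds up
  the contributions.\<close>

lemma norm_power_singular_vectors_le:
  fixes A :: "real ^ 'n ^ 'm" and v :: "'r::finite \<Rightarrow> real ^ 'n"
  assumes on: "\<And>i j. v i \<bullet> v j = (if i = j then 1 else 0)"
    and eig: "\<And>i. (transpose A ** A) *v v i = (s i)\<^sup>2 *\<^sub>R v i"
    and s: "\<And>i. 0 \<le> s i" "\<And>i. s i \<le> \<tau>"
  shows "norm ((mat_power (A ** transpose A) q ** A) *v ((\<chi> i j. v j $ i) *v b)) \<le> \<tau> ^ (2 * q + 1) * norm b"
proof -
  have pow: "mat_power (A ** transpose A) q *v (A *v v i) = (s i) ^ (2 * q) *\<^sub>R (A *v v i)" for i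
  proof (induction q)
    case (Suc q)
    have "(A ** transpose A) *v (A *v v i) = A *v ((transpose A ** A) *v v i)"
      by (simp add: matrix_vector_mul_assoc matrix_mul_assoc)
    also have "\<dots> = (s i)\<^sup>2 *\<^sub>R (A *v v i)"
      by (simp add: eig matrix_vector_mult_scaleR)
    finally show ?case
      using Suc
      by (simp add: mat_power_Suc matrix_vector_mul_assoc[symmetric] matrix_vector_mult_scaleR power2_eq_square)
  qed (simp add: mat_power_0)
  have inn: "(A *v v i) \<bullet> (A *v v j) = (if i = j then (s i)\<^sup>2 else 0)" for i j
    using eig[of j] on[of i j]
    by (auto simp: inner_transpose_mult(2)[of A] matrix_vector_mul_assoc)
  define u where "u i = (b $ i * s i ^ (2 * q)) *\<^sub>R (A *v v i)" for i
  have "(mat_power (A ** transpose A) q ** A) *v ((\<chi> i j. v j $ i) *v b) = (\<Sum>i\<in>UNIV. u i)"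
    by (simp add: matrix_of_columns linear_sum[OF matrix_vector_mul_linear]
        matrix_vector_mult_scaleR matrix_vector_mul_assoc[symmetric] pow u_def)
  moreover have "(norm (\<Sum>i\<in>UNIV. u i))\<^sup>2 = (\<Sum>i\<in>UNIV. (norm (u i))\<^sup>2)"
    by (rule norm_sum_Pythagorean) (auto simp: pairwise_def orthogonal_def u_def inn)
  moreover have "(norm (u i))\<^sup>2 \<le> (\<tau> ^ (2 * q + 1) * b $ i)\<^sup>2" for i
  proof -
    have "norm (A *v v i) = s i"
      using inn[of i i] s by (simp add: norm_eq_sqrt_inner)
    then have "norm (u i) = s i ^ (2 * q + 1) * \<bar>b $ i\<bar>"
      using s by (simp add: u_def abs_mult)
    also have "\<dots> \<le> \<tau> ^ (2 * q + 1) * \<bar>b $ i\<bar>"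
      by (intro mult_right_mono power_mono s) auto
    finally have "(norm (u i))\<^sup>2 \<le> (\<tau> ^ (2 * q + 1) * \<bar>b $ i\<bar>)\<^sup>2"
      by (rule power_mono) simp
    then show ?thesis by (simp add: power_mult_distrib)
  qed
  then have "(\<Sum>i\<in>UNIV. (norm (u i))\<^sup>2) \<le> (\<Sum>i\<in>UNIV. (\<tau> ^ (2 * q + 1) * b $ i)\<^sup>2)"
    by (rule sum_mono)
  moreover have "(\<Sum>i\<in>UNIV. (\<tau> ^ (2 * q + 1) * b $ i)\<^sup>2) = (\<tau> ^ (2 * q + 1) * norm b)\<^sup>2"
  proof -
    have "(norm b)\<^sup>2 = (\<Sum>i\<in>UNIV. (b $ i)\<^sup>2)"
      unfolding power2_norm_eq_inner inner_vec_def by (simp add: power2_eq_square)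
    then show ?thesis by (simp only: power_mult_distrib sum_distrib_left)
  qed
  ultimately have "(norm ((mat_power (A ** transpose A) q ** A) *v ((\<chi> i j. v j $ i) *v b)))\<^sup>2
      \<le> (\<tau> ^ (2 * q + 1) * norm b)\<^sup>2" by (simp only:)
  \<comment> \<open>Index types are nonempty, so some \<open>s i\<close> lies between 0 and
    \<open>\<tau>\<close>.\<close>
  moreover have "0 \<le> \<tau>" using s(1)[of undefined] s(2)[of undefined] by linarith
  ultimately show ?thesis by - (rule power2_le_imp_le, simp_all)
qed

section \<open>The residual in block coordinates\<close>

lemma hcat_mult:
  fixes B :: "real ^ 'a ^ 'r" and C :: "real ^ 'b ^ 'r"
  shows "hcat B C *v z = B *v (\<chi> i. z $ Inl i) + C *v (\<chi> i. z $ Inr i)"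
  by (simp add: vec_eq_iff hcat_def matrix_vector_mult_def sum_UNIV_sum_type)

lemma norm_sum_index:
  fixes z :: "real ^ ('a::finite + 'b::finite)"
  shows "(norm z)\<^sup>2 = (norm (\<chi> i. z $ Inl i))\<^sup>2 + (norm (\<chi> i. z $ Inr i))\<^sup>2"
  by (simp add: power2_norm_eq_inner inner_vec_def sum_UNIV_sum_type)

text \<open>
  For every \<open>x\<close> the correction \<open>z\<close> is chosen such that \<open>x - G z\<close> has no component in the range of
  \<open>V1\<close>; the remaining freedom in \<open>z\<close> removes the projection onto the range of \<open>x2\<close>.
\<close>

lemma spectral_norm_proj_residual_le:
  fixes B :: "real ^ 'n ^ 'm" and V1 :: "real ^ 'k ^ 'n" and V2 :: "real ^ 'r ^ 'n"
    and U1 :: "real ^ 'k ^ 'd" and U2 :: "real ^ 'p ^ 'd"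
    and x1 :: "real ^ 'k ^ 'r" and x2 :: "real ^ 'p ^ 'r" and R S S' :: "real ^ 'k ^ 'k"
  assumes V: "block_orthogonal V1 V2" and U: "block_orthogonal U1 U2"
    and B: "\<And>b. norm (B *v (V2 *v b)) \<le> \<tau> * norm b"
    and R: "R ** transpose R = mat 1" and S: "S ** S' = mat 1"
    and y: "transpose y ** U1 = R ** S" "transpose y ** U2 = 0"
  shows "spectral_norm (proj_residual B (V1 ** transpose y + V2 ** (x1 ** transpose U1 + x2 ** transpose U2)))
    \<le> \<tau> * spectral_norm (proj_residual (mat 1) x2 ** hcat (x1 ** S') (mat 1))"
proof (rule spectral_norm_leI)
  fix x
  define G where "G = V1 ** transpose y + V2 ** (x1 ** transpose U1 + x2 ** transpose U2)"
  define K where "K = proj_residual (mat 1) x2 ** hcat (x1 ** S') (mat 1)"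
  \<comment> \<open>The aim is \<open>transpose y *v z = transpose V1 *v x\<close>. Since
    \<open>transpose y\<close> sends \<open>U1 *v b\<close> to \<open>R *v (S *v b)\<close>, the
    \<open>U1\<close>-part of \<open>z\<close> must be \<open>S' *v a\<close> with this
    \<open>a\<close>.\<close>
  define a where "a = transpose R *v (transpose V1 *v x)"
  define c where "c = transpose V2 *v x - (x1 ** S') *v a"
  \<comment> \<open>\<open>c\<close> is what the \<open>U1\<close>-part of \<open>z\<close> leaves
    of the \<open>V2\<close>-component of \<open>x\<close>; with \<open>x2 *v u\<close> as the
    projection of \<open>c\<close> onto the range of \<open>x2\<close>, only the residual
    remains.\<close>
  obtain u where u: "residual x2 *v c = c - x2 *v u"
    using residual_eq by blast
  define z where "z = U1 *v (S' *v a) + U2 *v u"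
  have "transpose y *v z = (transpose y ** U1) *v (S' *v a) + (transpose y ** U2) *v u"
    by (simp add: z_def matrix_vector_right_distrib matrix_vector_mul_assoc matrix_mul_assoc)
  also have "\<dots> = (R ** (S ** S') ** transpose R) *v (transpose V1 *v x)"
    unfolding y by (simp add: a_def matrix_vector_mul_assoc matrix_mul_assoc)
  finally have yz: "transpose y *v z = transpose V1 *v x" by (simp add: R S)
  have "transpose U1 *v z = (transpose U1 ** U1) *v (S' *v a) + (transpose U1 ** U2) *v u"
    "transpose U2 *v z = (transpose U2 ** U1) *v (S' *v a) + (transpose U2 ** U2) *v u"
    by (simp_all add: z_def matrix_vector_right_distrib matrix_vector_mul_assoc matrix_mul_assoc)
  then have Uz: "transpose U1 *v z = S' *v a" "transpose U2 *v z = u"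
    using U by (simp_all add: block_orthogonal_def)
  have "G *v z = V1 *v (transpose V1 *v x) + V2 *v (x1 *v (S' *v a) + x2 *v u)"
    unfolding G_def
    by (simp add: matrix_vector_mult_add_rdistrib matrix_vector_mul_assoc[symmetric] yz Uz)
  moreover have "x = V1 *v (transpose V1 *v x) + V2 *v (transpose V2 *v x)"
    using V by (simp add: matrix_vector_mul_assoc matrix_vector_mult_add_rdistrib[symmetric] block_orthogonal_def)
  ultimately have "x - G *v z = V2 *v (transpose V2 *v x) - V2 *v (x1 *v (S' *v a) + x2 *v u)"
    by (metis add_diff_cancel_left)
  also have "\<dots> = V2 *v (residual x2 *v c)"
    by (simp only: u matrix_vector_mult_diff_distrib[symmetric])
      (simp add: c_def matrix_vector_mul_assoc[symmetric] diff_diff_eq)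
  finally have xG: "x - G *v z = V2 *v (residual x2 *v c)" .
  \<comment> \<open>The sign makes \<open>hcat (x1 ** S') (mat 1)\<close> send \<open>h\<close> to
    \<open>c\<close>; \<open>h\<close> has the norm of \<open>x\<close> because \<open>R\<close> and
    \<open>[V1 V2]\<close> are orthogonal.\<close>
  define h where "h = (\<chi> i. case i of Inl i \<Rightarrow> (- a) $ i | Inr j \<Rightarrow> (transpose V2 *v x) $ j)"
  have h: "(\<chi> i. h $ Inl i) = - a" "(\<chi> i. h $ Inr i) = transpose V2 *v x"
    by (simp_all add: h_def vec_eq_iff)
  have "hcat (x1 ** S') (mat 1) *v h = c"
    by (simp add: hcat_mult h c_def linear_neg[OF matrix_vector_mul_linear])
  then have Kh: "K *v h = residual x2 *v c"
    by (simp add: K_def proj_residual_def matrix_vector_mul_assoc[symmetric])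
  have "a \<bullet> a = (transpose V1 *v x) \<bullet> ((R ** transpose R) *v (transpose V1 *v x))"
    by (simp only: a_def inner_transpose_mult(1)[of R] matrix_vector_mul_assoc[of R])
  then have "norm a = norm (transpose V1 *v x)"
    by (simp add: R norm_eq_sqrt_inner)
  then have "(norm h)\<^sup>2 = (norm x)\<^sup>2"
    by (simp add: norm_sum_index[of h] h norm_transpose_block_orthogonal[OF V])
  then have nh: "norm h = norm x" by simp
  have tau: "0 \<le> \<tau>"
    using order_trans[OF norm_ge_zero B[of "axis undefined 1"]] by simp
  have "proj_residual B G *v x = residual (B ** G) *v (B *v x)"
    by (simp add: proj_residual_def matrix_vector_mul_assoc)
  then have "norm (proj_residual B G *v x) \<le> norm (B *v x - (B ** G) *v z)"
    by (simp add: residual_le_dist)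
  also have "B *v x - (B ** G) *v z = B *v (V2 *v (residual x2 *v c))"
    by (simp add: xG[symmetric] matrix_vector_mult_diff_distrib matrix_vector_mul_assoc[symmetric])
  also have "norm \<dots> \<le> \<tau> * norm (K *v h)"
    unfolding Kh by (rule B)
  also have "\<dots> \<le> \<tau> * (spectral_norm K * norm h)"
    by (intro mult_left_mono norm_mult_le_spectral_norm tau)
  finally show "norm (proj_residual B G *v x) \<le> \<tau> * spectral_norm K * norm x"
    by (simp add: nh)
qed

section \<open>Inverses of diagonal matrices and existence of the singular frames\<close>

lemma matrix_inv_eqI:
  fixes S :: "real ^ 'n ^ 'n"
  assumes "S ** S' = mat 1"
  shows "matrix_inv S = S'"
proof -
  have left: "S' ** S = mat 1" by (rule iffD1[OF matrix_left_right_inverse assms])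
  have "matrix_inv S ** S = mat 1"
    unfolding matrix_inv_def by (rule someI2[of _ S']) (simp_all add: assms left)
  then have "matrix_inv S ** (S ** S') = S'"
    by (simp add: matrix_mul_assoc)
  then show ?thesis by (simp add: assms)
qed

text \<open>Unlike \<open>matrix_inv\<close>, which is defined by choice, this entrywise formula is
  visibly Borel measurable in \<open>S\<close>.\<close>

definition diag_inv :: "real ^ 'n ^ 'n \<Rightarrow> real ^ 'n ^ 'n" where
  "diag_inv S = (\<chi> i j. if i = j then 1 / S $ i $ i else 0)"

lemma diagonal_matrix_mult:
  assumes "diagonal_matrix S"
  shows "(S ** B) $ i $ j = S $ i $ i * B $ i $ j" "(C ** S) $ i $ j = C $ i $ j * S $ j $ j"
proof -
  have "(S ** B) $ i $ j = (\<Sum>l\<in>UNIV. if l = i then S $ i $ i * B $ i $ j else 0)"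
    using assms unfolding matrix_matrix_mult_def diagonal_matrix_def vec_lambda_beta
    by (intro sum.cong) auto
  then show "(S ** B) $ i $ j = S $ i $ i * B $ i $ j" by simp
  have "(C ** S) $ i $ j = (\<Sum>l\<in>UNIV. if l = j then C $ i $ j * S $ j $ j else 0)"
    using assms unfolding matrix_matrix_mult_def diagonal_matrix_def vec_lambda_beta
    by (intro sum.cong) auto
  then show "(C ** S) $ i $ j = C $ i $ j * S $ j $ j" by simp
qed

lemma diagonal_mult_diag_inv:
  assumes "diagonal_matrix S" "\<And>i. S $ i $ i \<noteq> 0"
  shows "S ** diag_inv S = mat 1"
  using assms by (auto simp: vec_eq_iff diagonal_matrix_mult diag_inv_def mat_def)

text \<open>
  On a singular matrix \<open>matrix_inv\<close> is \<open>SOME x. False\<close>, a constant.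
\<close>

lemma matrix_inv_diagonal:
  assumes D: "diagonal_matrix S"
  shows "matrix_inv S = (if \<forall>i. S $ i $ i \<noteq> 0 then diag_inv S else (SOME x. False))"
proof (cases "\<forall>i. S $ i $ i \<noteq> 0")
  case True
  then show ?thesis using D by (simp add: diagonal_mult_diag_inv matrix_inv_eqI)
next
  case False
  then obtain i where i: "S $ i $ i = 0" by blast
  have "S ** B \<noteq> mat 1" for B
  proof
    assume "S ** B = mat 1"
    then have "(S ** B) $ i $ i = 1" by (simp add: mat_def)
    then show False by (simp add: diagonal_matrix_mult(1)[OF D] i)
  qed
  then have "matrix_inv S = (SOME x. False)" unfolding matrix_inv_def by simp
  then show ?thesis using i by auto
qed

text \<open>\<open>V1\<close> collects the right singular vectors with indices up to
  \<open>CARD('k)\<close>, \<open>V2\<close> the others. By the ordering,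
  \<open>\<sigma> (CARD('k) + 1)\<close> dominates all singular values belonging to
  \<open>V2\<close>, so the bound on powers applies.\<close>

lemma singular_frame_exists:
  fixes A :: "real ^ 'n ^ 'm"
  assumes sv: "has_singular_values A {1..CARD('n)} \<sigma>"
    and anti: "antimono_on {1..CARD('n)} \<sigma>"
    and card: "CARD('k) + CARD('r) = CARD('n)"
  obtains V1 :: "real ^ 'k::finite ^ 'n" and V2 :: "real ^ 'r::finite ^ 'n"
  where "block_orthogonal V1 V2"
    "\<And>q b. norm ((mat_power (A ** transpose A) q ** A) *v (V2 *v b)) \<le>
      \<sigma> (CARD('k) + 1) ^ (2 * q + 1) * norm b"
proof -
  obtain v where eig: "\<And>i. i \<in> {1..CARD('n)} \<Longrightarrow> (transpose A ** A) *v v i = (\<sigma> i)\<^sup>2 *\<^sub>R v i"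
    and on: "\<And>i j. i \<in> {1..CARD('n)} \<Longrightarrow> j \<in> {1..CARD('n)} \<Longrightarrow> v i \<bullet> v j = (if i = j then 1 else 0)"
    using singular_vectors_exist[OF sv] by metis
  \<comment> \<open>The column types carry no order; \<open>f\<close> and \<open>g\<close> identify
    them with the two ranges of indices.\<close>
  obtain f where f: "bij_betw f (UNIV :: 'k set) {1..CARD('k)}"
    using finite_same_card_bij[of "UNIV :: 'k set" "{1..CARD('k)}"] by auto
  have "card (UNIV :: 'r set) = card {CARD('k) + 1..CARD('n)}" using card by simp
  then obtain g where g: "bij_betw g (UNIV :: 'r set) {CARD('k) + 1..CARD('n)}"
    by (rule finite_same_card_bij[OF finite finite_atLeastAtMost, THEN exE])
  have fr: "f i \<in> {1..CARD('k)}" for i using f by (auto simp: bij_betw_def)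
  have gr: "g i \<in> {CARD('k) + 1..CARD('n)}" for i using g by (auto simp: bij_betw_def)
  define e where "e = case_sum f g"
  have er: "e z \<in> {1..CARD('n)}" for z
  proof (cases z)
    case (Inl i)
    then show ?thesis using fr[of i] card by (simp add: e_def)
  next
    case (Inr j)
    then show ?thesis using gr[of j] card by (simp add: e_def)
  qed
  have fg: "f i \<noteq> g j" "g j \<noteq> f i" for i j using fr[of i] gr[of j] by auto
  have inj: "e z = e z' \<longleftrightarrow> z = z'" for z z'
    using inj_eq[OF bij_betw_imp_inj_on[OF f]] inj_eq[OF bij_betw_imp_inj_on[OF g]] fg
    by (cases z; cases z') (simp_all add: e_def)
  have one: "v (e z) \<bullet> v (e z') = (if z = z' then 1 else 0)" for z z'
    using on[OF er er] inj by simp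
  have nn: "0 \<le> \<sigma> i" if "i \<in> {1..CARD('n)}" for i
    using sv that by (simp add: has_singular_values_def)
  show ?thesis
  proof (rule that)
    show "block_orthogonal (\<chi> i j. v (e (Inl j)) $ i) (\<chi> i j. v (e (Inr j)) $ i)"
      using block_orthogonalI[of "v \<circ> e"] one card by (simp add: comp_def)
    show "norm ((mat_power (A ** transpose A) q ** A) *v ((\<chi> i j. v (e (Inr j)) $ i) *v b)) \<le>
      \<sigma> (CARD('k) + 1) ^ (2 * q + 1) * norm b" for q b
    proof (rule norm_power_singular_vectors_le[where s = "\<lambda>j. \<sigma> (e (Inr j))"])
      show "v (e (Inr i)) \<bullet> v (e (Inr j)) = (if i = j then 1 else 0)" for i j
        by (simp add: one)
      show "0 \<le> \<sigma> (e (Inr i))" for i using nn er by blast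
      show "\<sigma> (e (Inr i)) \<le> \<sigma> (CARD('k) + 1)" for i
        using monotone_onD[OF anti, of "CARD('k) + 1" "g i"] gr[of i] by (simp add: e_def)
      show "(transpose A ** A) *v v (e (Inr i)) = (\<sigma> (e (Inr i)))\<^sup>2 *\<^sub>R v (e (Inr i))" for i
        by (rule eig[OF er])
    qed
  qed
qed

text \<open>The left singular vectors are \<open>Y *v r i\<close> divided by \<open>s i\<close>,
  where injectivity excludes \<open>s i = 0\<close>; \<open>U2\<close> completes them to an
  orthonormal basis. The right singular vectors are indexed like the diagonal of \<open>S\<close>,
  so its entries may come in any order.\<close>

lemma singular_decomposition_exists:
  fixes Y :: "real ^ 'k ^ 'd" and S :: "real ^ 'k ^ 'k"
  assumes sv: "has_singular_values Y UNIV (\<lambda>i. S $ i $ i)"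
    and D: "diagonal_matrix S"
    and inj: "\<And>x. Y *v x = 0 \<Longrightarrow> x = 0"
    and card: "CARD('k) + CARD('p) = CARD('d)"
  obtains U1 :: "real ^ 'k ^ 'd" and U2 :: "real ^ 'p::finite ^ 'd" and R :: "real ^ 'k ^ 'k"
  where "block_orthogonal U1 U2" "R ** transpose R = mat 1" "S ** matrix_inv S = mat 1"
    "transpose Y ** U1 = R ** S" "transpose Y ** U2 = 0"
proof -
  define s where "s i = S $ i $ i" for i
  obtain r where eig: "\<And>i. (transpose Y ** Y) *v r i = (s i)\<^sup>2 *\<^sub>R r i"
    and on: "\<And>i j. r i \<bullet> r j = (if i = j then 1 else 0)"
    using singular_vectors_exist[OF sv] unfolding s_def by auto
  have Yr: "(Y *v r i) \<bullet> (Y *v r j) = (if i = j then (s i)\<^sup>2 else 0)" for i j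
    using eig[of j] on[of i j] by (auto simp: inner_transpose_mult(2)[of Y] matrix_vector_mul_assoc)
  have pos: "s i > 0" for i
  proof -
    have "r i \<noteq> 0" using on[of i i] by auto
    then have "Y *v r i \<noteq> 0" using inj by blast
    then have "s i \<noteq> 0" using Yr[of i i] by auto
    moreover have "s i \<ge> 0" using sv by (simp add: has_singular_values_def s_def)
    ultimately show ?thesis by simp
  qed
  define w where "w i = (1 / s i) *\<^sub>R (Y *v r i)" for i
  have "w i \<bullet> w j = (if i = j then 1 else 0)" for i j
    using pos[of i] by (cases "i = j") (simp_all add: w_def Yr power2_eq_square)
  from orthonormal_extend[OF this card] obtain v :: "'k + 'p \<Rightarrow> real ^ 'd"
    where vw: "\<And>i. v (Inl i) = w i" and v: "\<And>i j. v i \<bullet> v j = (if i = j then 1 else 0)"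
    by metis
  define U1 U2 where "U1 = (\<chi> i j. v (Inl j) $ i)" and "U2 = (\<chi> i j. v (Inr j) $ i)"
  define R where "R = (\<chi> i j. r j $ i)"
  have "transpose R ** R = mat 1"
    using on by (simp add: vec_eq_iff matrix_matrix_mult_def transpose_def R_def inner_vec_def mat_def)
  then have RR: "R ** transpose R = mat 1" by (rule iffD1[OF matrix_left_right_inverse])
  have col: "column j U1 = w j" "column j R = r j" "column j' U2 = v (Inr j')" for j j'
    by (simp_all add: column_def U1_def U2_def R_def vw vec_eq_iff)
  have "transpose Y *v w j = s j *\<^sub>R r j" for j
    using pos[of j] by (simp add: w_def matrix_vector_mult_scaleR matrix_vector_mul_assoc eig power2_eq_square)
  then have "column j (transpose Y ** U1) = s j *\<^sub>R column j R" for j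
    by (simp add: column_mult col)
  then have 1: "transpose Y ** U1 = R ** S"
    by (simp add: vec_eq_iff column_def diagonal_matrix_mult[OF D] s_def mult.commute)
  \<comment> \<open>Each column of \<open>U2\<close> is orthogonal to all \<open>Y *v r i\<close>,
    and the \<open>r i\<close> span the whole space, so it is orthogonal to the range of
    \<open>Y\<close>.\<close>
  have 2: "transpose Y ** U2 = 0"
  proof -
    have "transpose Y *v v (Inr j) = 0" for j
    proof -
      let ?z = "transpose Y *v v (Inr j)"
      have "r i \<bullet> ?z = 0" for i
        using v[of "Inl i" "Inr j"] pos[of i]
        by (simp add: inner_transpose_mult(2)[symmetric] vw w_def)
      then have "transpose R *v ?z = 0"
        by (simp add: vec_eq_iff matrix_vector_mult_def transpose_def R_def inner_vec_def)
      then have "R *v (transpose R *v ?z) = 0" by simp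
      then show ?thesis by (simp add: matrix_vector_mul_assoc matrix_mul_assoc RR)
    qed
    then have "column j (transpose Y ** U2) = 0" for j
      by (simp add: column_mult col)
    then show ?thesis by (simp add: vec_eq_iff column_def)
  qed
  have "\<And>i. S $ i $ i \<noteq> 0" using pos by (metis less_irrefl s_def)
  then have "S ** matrix_inv S = mat 1"
    using D by (simp add: matrix_inv_diagonal diagonal_mult_diag_inv)
  moreover have "block_orthogonal U1 U2"
    unfolding U1_def U2_def by (rule block_orthogonalI[OF v card])
  ultimately show ?thesis using that RR 1 2 by blast
qed

section \<open>The standard Gaussian measure\<close>

text \<open>Stated for every Euclidean space, so that matrices and pairs of matrices share one
  rotation invariance.\<close>

definition gaussian :: "'a::euclidean_space measure" where
  "gaussian = density lborel (\<lambda>x. \<Prod>b\<in>Basis. ennreal (std_normal_density (x \<bullet> b)))"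

lemma sets_gaussian [simp, measurable_cong]: "sets gaussian = sets borel"
  and space_gaussian [simp]: "space gaussian = UNIV"
  by (simp_all add: gaussian_def)

text \<open>The squares of the coordinates add up to the squared norm. Dependence on the norm alone
  is what makes the measure rotation invariant.\<close>

lemma prod_std_normal_density:
  fixes x :: "'a::euclidean_space"
  shows "(\<Prod>b\<in>Basis. ennreal (std_normal_density (x \<bullet> b))) =
    ennreal ((1 / sqrt (2 * pi)) ^ DIM('a) * exp (- (norm x)\<^sup>2 / 2))"
proof -
  have "(norm x)\<^sup>2 = (\<Sum>b\<in>Basis. (x \<bullet> b)\<^sup>2)"
    by (simp add: norm_eq_sqrt_inner euclidean_inner[of x x] power2_eq_square sum_nonneg)
  then have "exp (- (norm x)\<^sup>2 / 2) = (\<Prod>b\<in>Basis. exp (- (x \<bullet> b)\<^sup>2 / 2))"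
    by (simp add: exp_sum[symmetric] sum_negf sum_divide_distrib)
  then show ?thesis
    by (subst prod_ennreal) (simp_all add: std_normal_density_def prod.distrib prod_dividef power_one_over)
qed

lemma prob_space_gaussian: "prob_space (gaussian :: 'a::euclidean_space measure)"
proof
  have "emeasure (gaussian :: 'a measure) UNIV =
      (\<Prod>b\<in>(Basis::'a set). \<integral>\<^sup>+x. ennreal (std_normal_density x) \<partial>lborel)"
    unfolding gaussian_def
    using nn_integral_lborel_prod[of "\<lambda>_::'a. \<lambda>x. ennreal (std_normal_density x)"]
    by (subst emeasure_density) simp_all
  moreover have "(\<integral>\<^sup>+x. ennreal (std_normal_density x) \<partial>lborel) = 1"
    using prob_space.emeasure_space_1[OF prob_space_normal_density[of 1 0]]
    by (simp add: emeasure_density)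
  ultimately show "emeasure (gaussian :: 'a measure) (space gaussian) = 1" by simp
qed

text \<open>The squared norm of a pair is the sum of the squared norms, so the density
  factors.\<close>

lemma gaussian_prod:
  "(gaussian :: ('a::euclidean_space \<times> 'b::euclidean_space) measure) = gaussian \<Otimes>\<^sub>M gaussian"
proof -
  have "(gaussian :: 'a measure) \<Otimes>\<^sub>M (gaussian :: 'b measure) =
     density (lborel \<Otimes>\<^sub>M lborel) (\<lambda>(x, y). (\<Prod>b\<in>Basis. ennreal (std_normal_density (x \<bullet> b))) *
        (\<Prod>b\<in>Basis. ennreal (std_normal_density (y \<bullet> b))))"
    unfolding gaussian_def
    by (rule pair_measure_density)
      (simp_all add: lborel.sigma_finite_measure_axioms gaussian_def[symmetric]
        prob_space_gaussian prob_space_imp_sigma_finite)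
  also have "(\<lambda>(x, y). (\<Prod>b\<in>Basis. ennreal (std_normal_density (x \<bullet> b))) *
        (\<Prod>b\<in>Basis. ennreal (std_normal_density (y \<bullet> b)))) =
     (\<lambda>z :: 'a \<times> 'b. \<Prod>b\<in>Basis. ennreal (std_normal_density (z \<bullet> b)))"
    by (auto simp: fun_eq_iff prod_std_normal_density norm_Pair ennreal_mult[symmetric]
        exp_add[symmetric] power_add field_simps add_divide_distrib[symmetric])
  finally show ?thesis
    unfolding lborel_prod by (simp add: gaussian_def)
qed

section \<open>Lebesgue measure under translations and isometries\<close>

lemma nn_integral_lborel_shift:
  fixes a :: "'a::euclidean_space"
  assumes [measurable]: "f \<in> borel_measurable borel"
  shows "(\<integral>\<^sup>+x. f (x + a) \<partial>lborel) = (\<integral>\<^sup>+x. f x \<partial>lborel)"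
    and "(\<integral>\<^sup>+x. f (a - x) \<partial>lborel) = (\<integral>\<^sup>+x. f x \<partial>lborel)"
proof -
  have "(lborel :: 'a measure) = distr lborel borel (\<lambda>x. a + 1 *\<^sub>R x)"
    using lborel_affine[of 1 a] by (simp add: density_1)
  then have "(\<integral>\<^sup>+x. f x \<partial>lborel) = (\<integral>\<^sup>+x. f x \<partial>distr lborel borel (\<lambda>x. a + 1 *\<^sub>R x))"
    by simp
  then show "(\<integral>\<^sup>+x. f (x + a) \<partial>lborel) = (\<integral>\<^sup>+x. f x \<partial>lborel)"
    by (simp add: nn_integral_distr add.commute)
  have "(lborel :: 'a measure) = distr lborel borel (\<lambda>x. a + (-1) *\<^sub>R x)"
    using lborel_affine[of "-1" a] by (simp add: density_1)
  then have "(\<integral>\<^sup>+x. f x \<partial>lborel) = (\<integral>\<^sup>+x. f x \<partial>distr lborel borel (\<lambda>x. a + (-1) *\<^sub>R x))"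
    by simp
  then show "(\<integral>\<^sup>+x. f (a - x) \<partial>lborel) = (\<integral>\<^sup>+x. f x \<partial>lborel)"
    by (simp add: nn_integral_distr)
qed

lemma linear_borel_measurable:
  fixes T :: "'a::euclidean_space \<Rightarrow> 'b::euclidean_space"
  shows "linear T \<Longrightarrow> T \<in> borel_measurable borel"
  by (intro borel_measurable_continuous_onI linear_continuous_on linear_conv_bounded_linear[THEN iffD1])

text \<open>Equal dimensions make the unit-ball volumes and the Gaussian normalizing constants agree
  on both sides.\<close>

lemma isometry_DIM_eq:
  fixes T :: "'a::euclidean_space \<Rightarrow> 'b::euclidean_space"
  assumes "linear T" "\<And>x. norm (T x) = norm x" "surj T"
  shows "DIM('a) = DIM('b)"
proof -
  have "inj T"
    using assms(1,2) by (metis linear_injective_0 norm_eq_zero)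
  then show ?thesis
    using dim_image_eq[OF assms(1), of UNIV] assms(3) by (simp add: inj_on_subset)
qed

text \<open>
  The uniqueness argument for Haar measure: Fubini and translation invariance compare the image
  measure with \<open>lborel\<close> on an arbitrary set and on the unit ball, which has the same volume for both.
\<close>

lemma distr_lborel_isometry:
  fixes T :: "'a::euclidean_space \<Rightarrow> 'b::euclidean_space"
  assumes T: "linear T" "\<And>x. norm (T x) = norm x" "surj T"
  shows "distr lborel borel T = lborel"
proof (rule measure_eqI)
  have [measurable]: "T \<in> borel_measurable borel"
    by (rule linear_borel_measurable) fact
  interpret linear T by fact
  fix A assume "A \<in> sets (distr lborel borel T)"
  then have [measurable]: "A \<in> sets borel" by simp
  define f :: "'b \<Rightarrow> ennreal" where "f = indicator (ball 0 1)"
  define g :: "'b \<Rightarrow> ennreal" where "g = indicator A"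
  have [measurable]: "f \<in> borel_measurable borel" "g \<in> borel_measurable borel"
    by (auto simp: f_def g_def intro!: borel_measurable_indicator)
  have "(\<integral>\<^sup>+x. f (T x) \<partial>lborel) * (\<integral>\<^sup>+y. g y \<partial>lborel) =
      (\<integral>\<^sup>+x. \<integral>\<^sup>+y. f (T x) * g (y + T x) \<partial>lborel \<partial>lborel)"
    by (simp add: nn_integral_cmult nn_integral_multc nn_integral_lborel_shift)
  also have "\<dots> = (\<integral>\<^sup>+y. \<integral>\<^sup>+x. f (T x) * g (y + T x) \<partial>lborel \<partial>lborel)"
    by (rule lborel_pair.Fubini') measurable
  also have "\<dots> = (\<integral>\<^sup>+y. \<integral>\<^sup>+x. f (T x - y) * g (T x) \<partial>lborel \<partial>lborel)"
  proof (rule nn_integral_cong)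
    fix y :: 'b
    \<comment> \<open>Surjectivity turns the translation by \<open>y\<close> in the image into a
      translation by \<open>a\<close> in the domain.\<close>
    obtain a where a: "T a = y" using T(3) by (metis surjD)
    have "(\<integral>\<^sup>+x. f (T x - y) * g (T x) \<partial>lborel) =
        (\<integral>\<^sup>+x. f (T (x + a) - y) * g (T (x + a)) \<partial>lborel)"
      by (rule nn_integral_lborel_shift(1)[symmetric]) measurable
    also have "\<dots> = (\<integral>\<^sup>+x. f (T x) * g (y + T x) \<partial>lborel)"
      by (simp add: add a add.commute)
    finally show "(\<integral>\<^sup>+x. f (T x) * g (y + T x) \<partial>lborel) = (\<integral>\<^sup>+x. f (T x - y) * g (T x) \<partial>lborel)"
      by simp
  qed
  also have "\<dots> = (\<integral>\<^sup>+x. \<integral>\<^sup>+y. f (T x - y) * g (T x) \<partial>lborel \<partial>lborel)"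
    by (rule lborel_pair.Fubini') measurable
  also have "\<dots> = (\<integral>\<^sup>+y. f y \<partial>lborel) * (\<integral>\<^sup>+x. g (T x) \<partial>lborel)"
    by (simp add: nn_integral_cmult nn_integral_multc nn_integral_lborel_shift)
  finally have eq: "(\<integral>\<^sup>+x. f (T x) \<partial>lborel) * (\<integral>\<^sup>+y. g y \<partial>lborel) =
      (\<integral>\<^sup>+y. f y \<partial>lborel) * (\<integral>\<^sup>+x. g (T x) \<partial>lborel)" .
  define V where "V = unit_ball_vol (real DIM('b))"
  have "(\<lambda>x. f (T x)) = indicator (ball 0 1)"
    by (auto simp: f_def fun_eq_iff T(2) split: split_indicator)
  then have "(\<integral>\<^sup>+x. f (T x) \<partial>lborel) = ennreal V"
    by (simp add: emeasure_ball V_def isometry_DIM_eq[OF T])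
  moreover have "(\<integral>\<^sup>+y. f y \<partial>lborel) = ennreal V"
    by (simp add: f_def emeasure_ball V_def)
  moreover have "V > 0" by (simp add: V_def)
  ultimately have "(\<integral>\<^sup>+y. g y \<partial>lborel) = (\<integral>\<^sup>+x. g (T x) \<partial>lborel)"
    using eq by (simp add: ennreal_mult_cancel_left)
  also have "\<dots> = emeasure (distr lborel borel T) A"
  proof -
    have "(\<lambda>x. g (T x)) = indicator (T -` A)"
      by (auto simp: g_def fun_eq_iff split: split_indicator)
    moreover have "T -` A \<in> sets borel"
      using measurable_sets[of T borel borel A] by simp
    ultimately show ?thesis
      by (simp add: emeasure_distr)
  qed
  finally show "emeasure (distr lborel borel T) A = emeasure lborel A"
    by (simp add: g_def)
qed simp

text \<open>The density depends on the norm only, which \<open>T\<close> preserves, and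
  \<open>T\<close> carries Lebesgue measure to Lebesgue measure.\<close>

lemma distr_gaussian_isometry:
  fixes T :: "'a::euclidean_space \<Rightarrow> 'b::euclidean_space"
  assumes T: "linear T" "\<And>x. norm (T x) = norm x" "surj T"
  shows "distr gaussian borel T = gaussian"
proof -
  have [measurable]: "T \<in> borel_measurable borel"
    by (rule linear_borel_measurable) fact
  have "(gaussian :: 'a measure) =
      density lborel ((\<lambda>y::'b. \<Prod>b\<in>Basis. ennreal (std_normal_density (y \<bullet> b))) \<circ> T)"
    unfolding gaussian_def prod_std_normal_density comp_def T(2) isometry_DIM_eq[OF T] ..
  then have "distr gaussian borel T = density (distr lborel borel T)
      (\<lambda>y::'b. \<Prod>b\<in>Basis. ennreal (std_normal_density (y \<bullet> b)))"
    by (subst density_distr) (simp_all add: comp_def)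
  then show ?thesis
    unfolding distr_lborel_isometry[OF T] gaussian_def .
qed

section \<open>Laws of matrices with independent standard normal entries\<close>

lemma gaussian_box:
  fixes l u :: "'a::euclidean_space"
  shows "emeasure gaussian (box l u) =
    (\<Prod>b\<in>Basis. emeasure (density lborel std_normal_density) {l \<bullet> b <..< u \<bullet> b})"
proof -
  have ind: "indicator (box l u) x = (\<Prod>b\<in>Basis. indicator {l \<bullet> b <..< u \<bullet> b} (x \<bullet> b) :: ennreal)" for x
    by (auto simp: box_def split: split_indicator)
  have "emeasure gaussian (box l u) = (\<integral>\<^sup>+x. (\<Prod>b\<in>Basis.
      ennreal (std_normal_density (x \<bullet> b)) * indicator {l \<bullet> b <..< u \<bullet> b} (x \<bullet> b)) \<partial>lborel)"
    unfolding gaussian_def by (subst emeasure_density) (simp_all add: ind prod.distrib)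
  also have "\<dots> = (\<Prod>b\<in>Basis. emeasure (density lborel std_normal_density) {l \<bullet> b <..< u \<bullet> b})"
    by (subst nn_integral_lborel_prod) (simp_all add: emeasure_density)
  finally show ?thesis .
qed

text \<open>Open boxes are stable under intersection, generate the Borel sets, and exhaust the space
  by sets of finite measure.\<close>

lemma measure_eq_boxI:
  fixes \<mu> \<nu> :: "'a::euclidean_space measure"
  assumes "prob_space \<mu>" "sets \<mu> = sets borel" "sets \<nu> = sets borel"
    "\<And>l u. emeasure \<mu> (box l u) = emeasure \<nu> (box l u)"
  shows "\<mu> = \<nu>"
proof (rule measure_eqI_generator_eq)
  let ?E = "range (\<lambda>(a, b). box a b :: 'a set)"
  show "Int_stable ?E"
    by (auto simp: Int_stable_def box_Int_box)
  show "?E \<subseteq> Pow UNIV" by simp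
  show "sets \<mu> = sigma_sets UNIV ?E" "sets \<nu> = sigma_sets UNIV ?E"
    unfolding assms(2,3) by (simp_all add: borel_eq_box)
  show "range (\<lambda>n::nat. box (- (real n *\<^sub>R One)) (real n *\<^sub>R One)) \<subseteq> ?E" by auto
  show "(\<Union>n::nat. box (- (real n *\<^sub>R One)) (real n *\<^sub>R One)) = (UNIV :: 'a set)"
    by (rule UN_box_eq_UNIV)
  show "emeasure \<mu> (box (- (real n *\<^sub>R One)) (real n *\<^sub>R One)) \<noteq> \<infinity>" for n :: nat
    using finite_measure.emeasure_finite[OF prob_space.finite_measure[OF assms(1)]] by simp
  show "emeasure \<mu> X = emeasure \<nu> X" if "X \<in> ?E" for X
    using that assms(4) by auto
qed

lemma borel_measurable_matI:
  fixes f :: "'w \<Rightarrow> real ^ 'c ^ 'r"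
  assumes "\<And>i j. (\<lambda>x. f x $ i $ j) \<in> borel_measurable M"
  shows "f \<in> borel_measurable M"
  unfolding borel_measurable_euclidean_space[of f] Basis_vec_def
  using assms by (auto simp: inner_axis)

lemma prod_Basis_mat:
  "(\<Prod>b\<in>Basis. f b) = (\<Prod>(i, j)\<in>UNIV. f (axis i (axis j 1) :: real ^ 'c ^ 'r))"
proof -
  have B: "(Basis :: (real ^ 'c ^ 'r) set) = (\<lambda>(i, j). axis i (axis j 1)) ` UNIV"
    by (auto simp: Basis_vec_def)
  have "inj (\<lambda>(i, j). axis i (axis j 1) :: real ^ 'c ^ 'r)"
    by (auto simp: inj_def axis_eq_axis)
  then show ?thesis
    unfolding B by (subst prod.reindex) (auto intro!: prod.cong)
qed

lemma iid_std_normal_measurable: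
  assumes "iid_std_normal M X"
  shows "X \<in> borel_measurable M"
proof (rule borel_measurable_matI)
  fix i j
  have "distributed M lborel (\<lambda>\<omega>. X \<omega> $ i $ j) std_normal_density"
    using assms by (simp add: iid_std_normal_def)
  then show "(\<lambda>\<omega>. X \<omega> $ i $ j) \<in> borel_measurable M"
    using distributed_measurable by fastforce
qed

text \<open>On a box, independence factors the probability over the entries, each contributing the
  normal measure of an interval; \<open>gaussian_box\<close> gives the same product.\<close>

lemma iid_std_normal_distr:
  fixes X :: "'w \<Rightarrow> real ^ 'c ^ 'r"
  assumes M: "prob_space M" and X: "iid_std_normal M X"
  shows "distr M borel X = gaussian"
proof (rule measure_eq_boxI)
  interpret prob_space M by fact
  have [measurable]: "X \<in> borel_measurable M"
    by (rule iid_std_normal_measurable) fact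
  show "prob_space (distr M borel X)" by (rule prob_space_distr) measurable
  fix l u :: "real ^ 'c ^ 'r"
  let ?S = "\<lambda>(i, j). {l $ i $ j <..< u $ i $ j}"
  have iv: "indep_vars (\<lambda>_. borel) (\<lambda>(i, j) \<omega>. X \<omega> $ i $ j) UNIV"
    and di: "\<And>i j. distributed M lborel (\<lambda>\<omega>. X \<omega> $ i $ j) std_normal_density"
    using X by (auto simp: iid_std_normal_def)
  have box: "X \<omega> \<in> box l u \<longleftrightarrow> (\<forall>z. (case z of (i, j) \<Rightarrow> \<lambda>\<omega>. X \<omega> $ i $ j) \<omega> \<in> ?S z)" for \<omega>
    by (auto simp: box_def Basis_vec_def inner_axis)
  have "emeasure (distr M borel X) (box l u) = emeasure M (X -` box l u \<inter> space M)"
    by (rule emeasure_distr) auto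
  also have "X -` box l u \<inter> space M =
      (\<Inter>z\<in>UNIV. (case z of (i, j) \<Rightarrow> \<lambda>\<omega>. X \<omega> $ i $ j) -` ?S z \<inter> space M)"
    using box by auto
  also have "emeasure M \<dots> = (\<Prod>z\<in>UNIV. emeasure M
      ((case z of (i, j) \<Rightarrow> \<lambda>\<omega>. X \<omega> $ i $ j) -` ?S z \<inter> space M))"
    unfolding emeasure_eq_measure
    by (subst indep_varsD[OF iv]) (auto simp: prod_ennreal)
  also have "\<dots> = (\<Prod>(i, j)\<in>UNIV. emeasure (density lborel std_normal_density) {l $ i $ j <..< u $ i $ j})"
  proof (intro prod.cong refl, clarify)
    fix i j
    have "density lborel std_normal_density = distr M lborel (\<lambda>\<omega>. X \<omega> $ i $ j)"
      using distributed_distr_eq_density[OF di] by simp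
    moreover have "(\<lambda>\<omega>. X \<omega> $ i $ j) \<in> measurable M lborel"
      by (rule distributed_measurable[OF di])
    ultimately show "emeasure M ((\<lambda>\<omega>. X \<omega> $ i $ j) -` {l $ i $ j <..< u $ i $ j} \<inter> space M) =
        emeasure (density lborel std_normal_density) {l $ i $ j <..< u $ i $ j}"
      by (simp only:) (subst emeasure_distr; simp)
  qed
  also have "\<dots> = emeasure gaussian (box l u)"
    by (simp add: gaussian_box prod_Basis_mat inner_axis)
  finally show "emeasure (distr M borel X) (box l u) = emeasure gaussian (box l u)" .
qed simp_all

section \<open>Measurability\<close>

lemma borel_measurable_mat_nth [measurable (raw)]:
  fixes f :: "'w \<Rightarrow> real ^ 'c ^ 'r"
  assumes "f \<in> borel_measurable M"
  shows "(\<lambda>x. f x $ i $ j) \<in> borel_measurable M"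
proof (rule measurable_compose[OF assms])
  show "(\<lambda>B :: real ^ 'c ^ 'r. B $ i $ j) \<in> borel_measurable borel"
    by (intro borel_measurable_continuous_onI continuous_intros)
qed

lemma borel_measurable_mat_mult [measurable (raw)]:
  fixes f :: "'w \<Rightarrow> real ^ 'c ^ 'r" and g :: "'w \<Rightarrow> real ^ 'd ^ 'c"
  assumes [measurable]: "f \<in> borel_measurable M" "g \<in> borel_measurable M"
  shows "(\<lambda>x. f x ** g x) \<in> borel_measurable M"
  by (rule borel_measurable_matI) (simp add: matrix_matrix_mult_def)

lemma borel_measurable_transpose [measurable (raw)]:
  fixes f :: "'w \<Rightarrow> real ^ 'c ^ 'r"
  assumes [measurable]: "f \<in> borel_measurable M"
  shows "(\<lambda>x. transpose (f x)) \<in> borel_measurable M"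
  by (rule borel_measurable_matI) (simp add: transpose_def)

lemma borel_measurable_hcat [measurable (raw)]:
  fixes f :: "'w \<Rightarrow> real ^ 'a ^ 'r" and g :: "'w \<Rightarrow> real ^ 'b ^ 'r"
  assumes [measurable]: "f \<in> borel_measurable M" "g \<in> borel_measurable M"
  shows "(\<lambda>x. hcat (f x) (g x)) \<in> borel_measurable M"
proof (rule borel_measurable_matI)
  fix i j
  show "(\<lambda>x. hcat (f x) (g x) $ i $ j) \<in> borel_measurable M"
    by (cases j) (simp_all add: hcat_def)
qed

lemma continuous_on_mat_vec_mult:
  fixes x :: "real ^ 'c"
  shows "continuous_on UNIV (\<lambda>B :: real ^ 'c ^ 'r. B *v x)"
  unfolding matrix_vector_mult_def by (intro continuous_intros)

text \<open>The norm is a supremum of quotients continuous in \<open>B\<close>, so the sets where it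
  exceeds \<open>t\<close> are unions of open sets. Multiplying by \<open>norm x\<close> avoids
  division by zero.\<close>

lemma borel_measurable_spectral_norm [measurable]:
  "(spectral_norm :: real ^ 'c ^ 'r \<Rightarrow> real) \<in> borel_measurable borel"
proof -
  have "{B :: real ^ 'c ^ 'r. t < spectral_norm B} = (\<Union>x. {B. t * norm x < norm (B *v x)})" for t
  proof (intro set_eqI iffI)
    fix B :: "real ^ 'c ^ 'r"
    assume "B \<in> {B. t < spectral_norm B}"
    then have "\<not> (\<forall>x. norm (B *v x) \<le> t * norm x)"
      using spectral_norm_leI[of B t] by auto
    then show "B \<in> (\<Union>x. {B. t * norm x < norm (B *v x)})" by (auto simp: not_le)
  next
    fix B :: "real ^ 'c ^ 'r"
    assume "B \<in> (\<Union>x. {B. t * norm x < norm (B *v x)})"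
    then obtain x where "t * norm x < norm (B *v x)" by blast
    also have "\<dots> \<le> spectral_norm B * norm x" by (rule norm_mult_le_spectral_norm)
    finally have "t < spectral_norm B" using mult_right_less_imp_less norm_ge_zero by blast
    then show "B \<in> {B. t < spectral_norm B}" by simp
  qed
  moreover have "open (\<Union>x. {B :: real ^ 'c ^ 'r. t * norm x < norm (B *v x)})" for t
    by (intro open_UN ballI open_Collect_less continuous_intros continuous_on_mat_vec_mult)
  ultimately show ?thesis
    by (simp add: borel_measurable_iff_greater)
qed

text \<open>The projector may jump where the rank of \<open>F\<close> drops, but the norm of the
  residual is an infimum over \<open>y\<close> of functions continuous in \<open>F\<close>, so its
  strict sublevel sets are open.\<close>

lemma borel_measurable_norm_residual:
  fixes x :: "real ^ 'r"
  shows "(\<lambda>F :: real ^ 'c ^ 'r. norm (residual F *v x)) \<in> borel_measurable borel"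
proof -
  have "{F :: real ^ 'c ^ 'r. norm (residual F *v x) < t} = (\<Union>y. {F. norm (x - F *v y) < t})" for t
  proof (intro set_eqI iffI)
    fix F :: "real ^ 'c ^ 'r"
    assume "F \<in> {F. norm (residual F *v x) < t}"
    then show "F \<in> (\<Union>y. {F. norm (x - F *v y) < t})"
      using residual_eq[of F x] by auto
  next
    fix F :: "real ^ 'c ^ 'r"
    assume "F \<in> (\<Union>y. {F. norm (x - F *v y) < t})"
    then obtain y where "norm (x - F *v y) < t" by blast
    then show "F \<in> {F. norm (residual F *v x) < t}"
      using residual_le_dist[of F x y] by simp
  qed
  moreover have "open (\<Union>y. {F :: real ^ 'c ^ 'r. norm (x - F *v y) < t})" for t
    by (intro open_UN ballI open_Collect_less continuous_intros continuous_on_mat_vec_mult)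
  ultimately show ?thesis
    by (simp add: borel_measurable_iff_less)
qed

text \<open>Polarization, with \<open>I - P\<close> symmetric and idempotent, expresses the entries
  through norms of residuals, which are Borel in \<open>F\<close>.\<close>

lemma residual_nth:
  "residual F $ i $ j = ((norm (residual F *v (axis i 1 + axis j 1)))\<^sup>2 -
     (norm (residual F *v (axis i 1 - axis j 1)))\<^sup>2) / 4"
proof -
  have "residual F $ i $ j = (residual F *v axis j 1) \<bullet> axis i 1"
    by (simp add: matrix_vector_mult_basis column_def inner_axis)
  also have "\<dots> = (residual F *v axis i 1) \<bullet> (residual F *v axis j 1)"
    by (metis inner_commute inner_residual)
  finally show ?thesis
    by (simp add: matrix_vector_right_distrib matrix_vector_mult_diff_distrib power2_norm_eq_inner
        inner_add_left inner_add_right inner_diff_left inner_diff_right inner_commute)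
qed

lemma borel_measurable_residual [measurable]:
  "(\<lambda>F :: real ^ 'c ^ 'r. residual F) \<in> borel_measurable borel"
  by (rule borel_measurable_matI)
    (unfold residual_nth, intro borel_measurable_divide borel_measurable_diff borel_measurable_power
      borel_measurable_norm_residual borel_measurable_const)

lemma borel_measurable_diag_inv [measurable]:
  "(diag_inv :: real ^ 'k ^ 'k \<Rightarrow> _) \<in> borel_measurable borel"
proof (rule borel_measurable_matI)
  fix i j :: 'k
  show "(\<lambda>S. diag_inv S $ i $ j) \<in> borel_measurable borel"
    by (cases "i = j") (simp_all add: diag_inv_def)
qed

text \<open>\<open>W\<close> as a function of \<open>X1\<close>, \<open>X2\<close> and
  \<open>\<Sigma>\<close>. The inverse is written out as in \<open>matrix_inv_diagonal\<close>, with
  its constant value on singular matrices, so the function is Borel everywhere and agrees with the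
  original expression for diagonal \<open>S\<close>.\<close>

definition diag_bound :: "real ^ 'k ^ 'r \<Rightarrow> real ^ 'p ^ 'r \<Rightarrow> real ^ 'k ^ 'k \<Rightarrow> real" where
  "diag_bound x1 x2 S = spectral_norm (residual x2 **
     hcat (x1 ** (if \<forall>i. S $ i $ i \<noteq> 0 then diag_inv S else (SOME x. False))) (mat 1))"

lemma proj_residual_id: "proj_residual (mat 1) F = residual F"
  by (simp add: proj_residual_def)

lemma spectral_norm_eq_diag_bound:
  "diagonal_matrix S \<Longrightarrow>
   spectral_norm (proj_residual (mat 1) x2 ** hcat (x1 ** matrix_inv S) (mat 1)) = diag_bound x1 x2 S"
  by (simp add: diag_bound_def proj_residual_id matrix_inv_diagonal)

lemma borel_measurable_diag_bound [measurable (raw)]: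
  assumes [measurable]: "f \<in> borel_measurable M" "g \<in> borel_measurable M" "h \<in> borel_measurable M"
  shows "(\<lambda>x. diag_bound (f x) (g x) (h x)) \<in> borel_measurable M"
  unfolding diag_bound_def by measurable

section \<open>Gaussian matrices are almost surely injective\<close>

text \<open>Applying \<open>Z - d\<close> to a linear relation removes the eigenvector for
  \<open>d\<close> and multiplies the coefficient of every other eigenvalue \<open>c\<close> by the
  nonzero number \<open>c - d\<close>.\<close>

lemma eigenvectors_coefficients_zero:
  fixes Z :: "real ^ 'k ^ 'k"
  assumes "finite C" "\<And>c. c \<in> C \<Longrightarrow> Z *v x c = c *\<^sub>R x c \<and> x c \<noteq> 0" "(\<Sum>c\<in>C. a c *\<^sub>R x c) = 0"
  shows "\<forall>c\<in>C. a c = 0"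
  using assms
proof (induction C arbitrary: a rule: finite_induct)
  case (insert d C)
  have sum0: "a d *\<^sub>R x d + (\<Sum>c\<in>C. a c *\<^sub>R x c) = 0"
    using insert by simp
  have "0 = Z *v (a d *\<^sub>R x d + (\<Sum>c\<in>C. a c *\<^sub>R x c)) - d *\<^sub>R (a d *\<^sub>R x d + (\<Sum>c\<in>C. a c *\<^sub>R x c))"
    by (simp add: sum0)
  also have "\<dots> = (\<Sum>c\<in>C. (a c * (c - d)) *\<^sub>R x c)"
    using insert.prems(1)
    by (simp add: matrix_vector_right_distrib linear_sum[OF matrix_vector_mul_linear] matrix_vector_mult_scaleR
        scaleR_sum_right sum_subtractf[symmetric] algebra_simps cong: sum.cong)
  finally have "\<forall>c\<in>C. a c * (c - d) = 0"
    using insert.IH[of "\<lambda>c. a c * (c - d)"] insert.prems(1) by simp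
  then have "\<forall>c\<in>C. a c = 0" using insert.hyps by auto
  moreover have "a d = 0" using sum0 calculation insert.prems(1)[of d] by simp
  ultimately show ?case by simp
qed simp

text \<open>More than \<open>CARD('k)\<close> eigenvectors for distinct eigenvalues would be
  linearly dependent, contrary to the preceding lemma.\<close>

lemma finite_eigenvalues:
  fixes Z :: "real ^ 'k ^ 'k"
  shows "finite {c. \<exists>x. x \<noteq> 0 \<and> Z *v x = c *\<^sub>R x}"
proof (rule ccontr)
  assume inf: "infinite {c. \<exists>x. x \<noteq> 0 \<and> Z *v x = c *\<^sub>R x}"
  obtain C where C: "C \<subseteq> {c. \<exists>x. x \<noteq> 0 \<and> Z *v x = c *\<^sub>R x}" "finite C" "card C = CARD('k) + 1"
    using infinite_arbitrarily_large[OF inf, of "CARD('k) + 1"] by blast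
  define x where "x c = (SOME x. x \<noteq> 0 \<and> Z *v x = c *\<^sub>R x)" for c
  have x: "Z *v x c = c *\<^sub>R x c \<and> x c \<noteq> 0" if "c \<in> C" for c
    using someI_ex[of "\<lambda>x. x \<noteq> 0 \<and> Z *v x = c *\<^sub>R x"] that C(1) by (auto simp: x_def)
  have inj: "inj_on x C"
  proof (rule inj_onI)
    fix c d assume cd: "c \<in> C" "d \<in> C" "x c = x d"
    have "Z *v x c = c *\<^sub>R x c" "Z *v x d = d *\<^sub>R x d" "x c \<noteq> 0"
      using x cd(1,2) by blast+
    then have "c *\<^sub>R x c = d *\<^sub>R x c" by (metis cd(3))
    then show "c = d" using \<open>x c \<noteq> 0\<close> by (metis scaleR_right_imp_eq)
  qed
  then have "card (x ` C) > DIM(real ^ 'k)" using C by (simp add: card_image)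
  then have "dependent (x ` C)" using C by (intro dependent_biggerset) auto
  then obtain u c where u: "c \<in> C" "u (x c) \<noteq> 0" "(\<Sum>v\<in>x ` C. u v *\<^sub>R v) = 0"
    using dependent_finite[of "x ` C"] C by auto
  then have "(\<Sum>c\<in>C. u (x c) *\<^sub>R x c) = 0" using inj by (simp add: sum.reindex)
  from eigenvectors_coefficients_zero[OF C(2) x this] u show False by auto
qed

text \<open>
  For fixed \<open>y\<close> and an injective \<open>E\<close>, the matrix \<open>y + c E\<close> is injective for all but finitely many \<open>c\<close>,
  since a kernel vector is an eigenvector of a fixed square matrix. Averaging over \<open>c \<in> [0, 1]\<close> and
  translating by \<open>c E\<close> then shows that the set is null.
\<close>

lemma singular_in_null_sets_lborel:
  assumes card: "CARD('k) \<le> CARD('d)"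
  shows "{y :: real ^ 'k ^ 'd. \<exists>x. x \<noteq> 0 \<and> y *v x = 0} \<in> null_sets lborel"
proof -
  define S where "S = {y :: real ^ 'k ^ 'd. \<exists>x. x \<noteq> 0 \<and> y *v x = 0}"
  \<comment> \<open>An injective linear map is bounded below by a positive constant, which may be
    taken as \<open>1 / Suc n\<close>. So the complement is a countable union of closed sets, and
    \<open>S\<close> is Borel.\<close>
  have "- S = (\<Union>n. \<Inter>x. {y. norm x / real (Suc n) \<le> norm (y *v x)})"
  proof (intro set_eqI iffI)
    fix y assume "y \<in> - S"
    then have "\<And>x. y *v x = 0 \<Longrightarrow> x = 0" by (auto simp: S_def)
    then have "inj ((*v) y)"
      by (simp add: linear_injective_0[OF matrix_vector_mul_linear])
    then obtain B where B: "B > 0" "\<And>x. B * norm x \<le> norm (y *v x)"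
      using linear_inj_bounded_below_pos[OF matrix_vector_mul_linear] by blast
    obtain n where n: "inverse (real (Suc n)) < B" using reals_Archimedean[OF B(1)] by blast
    have "norm x / real (Suc n) \<le> norm (y *v x)" for x
      using order_trans[OF mult_right_mono[OF less_imp_le[OF n] norm_ge_zero[of x]] B(2)]
      by (simp add: divide_inverse mult.commute)
    then show "y \<in> (\<Union>n. \<Inter>x. {y. norm x / real (Suc n) \<le> norm (y *v x)})" by auto
  next
    fix y :: "real ^ 'k ^ 'd"
    assume "y \<in> (\<Union>n. \<Inter>x. {y. norm x / real (Suc n) \<le> norm (y *v x)})"
    then obtain n where n: "\<And>x. norm x / real (Suc n) \<le> norm (y *v x)" by blast
    have "x = 0" if "y *v x = 0" for x
    proof (rule ccontr)
      assume "x \<noteq> 0"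
      then have "0 < norm x / real (Suc n)" by simp
      with n[of x] that show False by simp
    qed
    then show "y \<in> - S" by (auto simp: S_def)
  qed
  moreover have "closed (\<Inter>x. {y :: real ^ 'k ^ 'd. norm x / real (Suc n) \<le> norm (y *v x)})" for n
    by (intro closed_INT ballI closed_Collect_le continuous_intros continuous_on_mat_vec_mult)
  ultimately have "- S \<in> sets borel" by auto
  then have [measurable]: "S \<in> sets borel" by (metis borel_comp double_compl)
  obtain e :: "'k \<Rightarrow> 'd" where e: "inj e"
    using card by (metis card_le_inj finite inj_on_def)
  define E :: "real ^ 'k ^ 'd" where "E = (\<chi> i j. if i = e j then 1 else 0)"
  have fin: "finite {c. y + c *\<^sub>R E \<in> S}" for y
  proof -
    \<comment> \<open>\<open>Z\<close> consists of the rows of \<open>y\<close> in which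
      \<open>E\<close> has its ones; there \<open>(y + c *\<^sub>R E) *v x = 0\<close> reads
      \<open>Z *v x = - c *\<^sub>R x\<close>.\<close>
    define Z where "Z = (\<chi> i. y $ e i)"
    have "c \<in> uminus ` {c. \<exists>x. x \<noteq> 0 \<and> Z *v x = c *\<^sub>R x}" if S: "y + c *\<^sub>R E \<in> S" for c
    proof -
      obtain x where x: "x \<noteq> 0" "(y + c *\<^sub>R E) *v x = 0" using S by (auto simp: S_def)
      have "(Z *v x) $ i = (- c *\<^sub>R x) $ i" for i
      proof -
        have "0 = ((y + c *\<^sub>R E) *v x) $ e i" using x by simp
        also have "\<dots> = (Z *v x) $ i + (\<Sum>j\<in>UNIV. c * (if i = j then 1 else 0) * x $ j)"
          using e by (simp add: matrix_vector_mult_def Z_def E_def distrib_right sum.distrib inj_eq)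
        also have "(\<Sum>j\<in>UNIV. c * (if i = j then 1 else 0) * x $ j) = (\<Sum>j\<in>UNIV. if j = i then c * x $ i else 0)"
          by (rule sum.cong) auto
        finally show ?thesis by simp
      qed
      then have "Z *v x = - c *\<^sub>R x" by (simp add: vec_eq_iff)
      then show ?thesis using x by (intro image_eqI[of _ _ "- c"]) auto
    qed
    then have "{c. y + c *\<^sub>R E \<in> S} \<subseteq> uminus ` {c. \<exists>x. x \<noteq> 0 \<and> Z *v x = c *\<^sub>R x}" by blast
    then show ?thesis using finite_eigenvalues finite_surj by blast
  qed
  have "emeasure lborel S = (\<integral>\<^sup>+c. indicator {0..1} c * emeasure lborel S \<partial>(lborel :: real measure))"
    by (simp add: nn_integral_multc)
  also have "\<dots> = (\<integral>\<^sup>+c. \<integral>\<^sup>+y. indicator {0..1} (c :: real) * indicator S (y + c *\<^sub>R E) \<partial>lborel \<partial>lborel)"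
    by (intro nn_integral_cong) (simp add: nn_integral_cmult nn_integral_lborel_shift(1)[of "indicator S"])
  also have "\<dots> = (\<integral>\<^sup>+y. \<integral>\<^sup>+c. indicator {0..1} (c :: real) * indicator S (y + c *\<^sub>R E) \<partial>lborel \<partial>lborel)"
    by (rule lborel_pair.Fubini') measurable
  also have "\<dots> = (\<integral>\<^sup>+(y :: real ^ 'k ^ 'd). 0 \<partial>lborel)"
  proof (rule nn_integral_cong)
    fix y
    have "AE c in lborel. c \<notin> {c. y + c *\<^sub>R E \<in> S}"
      by (rule AE_not_in) (simp add: fin finite_imp_null_set_lborel)
    then have "(\<integral>\<^sup>+c. indicator {0..1} (c :: real) * indicator S (y + c *\<^sub>R E) \<partial>lborel) = (\<integral>\<^sup>+(c :: real). 0 \<partial>lborel)"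
      by (intro nn_integral_cong_AE) (auto split: split_indicator)
    then show "(\<integral>\<^sup>+c. indicator {0..1} (c :: real) * indicator S (y + c *\<^sub>R E) \<partial>lborel) = 0" by simp
  qed
  finally show ?thesis unfolding S_def[symmetric] by (simp add: null_sets_def)
qed

lemma AE_gaussian_injective:
  assumes "CARD('k) \<le> CARD('d)"
  shows "AE y in gaussian. \<forall>x. (y :: real ^ 'k ^ 'd) *v x = 0 \<longrightarrow> x = 0"
proof -
  have "AE y in lborel. \<forall>x. (y :: real ^ 'k ^ 'd) *v x = 0 \<longrightarrow> x = 0"
    using AE_not_in[OF singular_in_null_sets_lborel[OF assms]] by (rule eventually_mono) blast
  then show ?thesis
    unfolding gaussian_def by (subst AE_density) (auto elim: eventually_mono)
qed

section \<open>Independence\<close>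

text \<open>Intersection-stable independent families, grouped over disjoint index sets, generate
  independent sigma-algebras. The group \<open>J\<close> allows \<open>Y\<close> to be a pair of
  variables of different value types.\<close>

lemma (in prob_space) distr_pair_of_indep_sets:
  assumes indep: "indep_sets E I" and sub: "i0 \<in> I" "J \<subseteq> I" "i0 \<notin> J"
    and stable: "\<And>i. i \<in> insert i0 J \<Longrightarrow> Int_stable (E i)"
    and X: "X \<in> measurable M S" "{X -` A \<inter> space M | A. A \<in> sets S} \<subseteq> sigma_sets (space M) (E i0)"
    and Y: "Y \<in> measurable M T" "{Y -` A \<inter> space M | A. A \<in> sets T} \<subseteq> sigma_sets (space M) (\<Union>i\<in>J. E i)"
  shows "distr M (S \<Otimes>\<^sub>M T) (\<lambda>\<omega>. (X \<omega>, Y \<omega>)) = distr M S X \<Otimes>\<^sub>M distr M T Y"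
proof -
  let ?I = "\<lambda>b. if b then {i0} else J"
  have "indep_sets (\<lambda>b. sigma_sets (space M) (\<Union>i\<in>?I b. E i)) (UNIV :: bool set)"
  proof (rule indep_sets_collect_sigma)
    show "indep_sets E (\<Union>b\<in>UNIV. ?I b)"
      by (rule indep_sets_mono_index[OF _ indep]) (use sub in auto)
    show "Int_stable (E i)" if "i \<in> ?I b" for b i
      using that stable by (auto split: if_splits)
    show "disjoint_family_on ?I UNIV"
      using sub by (auto simp: disjoint_family_on_def)
  qed
  then have "indep_set (sigma_sets (space M) (E i0)) (sigma_sets (space M) (\<Union>i\<in>J. E i))"
    unfolding indep_set_def by (rule indep_sets_cong[THEN iffD1, rotated -1]) (auto split: bool.split)
  note ind = indep_setD[OF this]
  note [measurable] = X(1) Y(1)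
  interpret DX: prob_space "distr M S X" by (rule prob_space_distr) measurable
  interpret DY: prob_space "distr M T Y" by (rule prob_space_distr) measurable
  show ?thesis
  proof (rule pair_measure_eqI[symmetric])
    fix A B assume "A \<in> sets (distr M S X)" "B \<in> sets (distr M T Y)"
    then have [measurable]: "A \<in> sets S" "B \<in> sets T" by auto
    have "(\<lambda>\<omega>. (X \<omega>, Y \<omega>)) -` (A \<times> B) \<inter> space M = (X -` A \<inter> space M) \<inter> (Y -` B \<inter> space M)"
      by auto
    moreover have "prob ((X -` A \<inter> space M) \<inter> (Y -` B \<inter> space M)) =
        prob (X -` A \<inter> space M) * prob (Y -` B \<inter> space M)"
      using X(2) Y(2) by (intro ind) (auto intro!: subsetD[OF X(2)] subsetD[OF Y(2)])
    ultimately show "emeasure (distr M S X) A * emeasure (distr M T Y) B =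
        emeasure (distr M (S \<Otimes>\<^sub>M T) (\<lambda>\<omega>. (X \<omega>, Y \<omega>))) (A \<times> B)"
      by (simp add: emeasure_distr emeasure_eq_measure ennreal_mult)
  qed (simp_all add: DX.sigma_finite_measure_axioms DY.sigma_finite_measure_axioms cong: sets_pair_measure_cong)
qed

lemma Int_stable_rv_sets: "Int_stable (rv_sets M X)"
proof (rule Int_stableI)
  fix a b assume "a \<in> rv_sets M X" "b \<in> rv_sets M X"
  then obtain A B where "A \<in> sets borel" "B \<in> sets borel" "a = X -` A \<inter> space M" "b = X -` B \<inter> space M"
    by (auto simp: rv_sets_def)
  then show "a \<inter> b \<in> rv_sets M X"
    by (auto simp: rv_sets_def intro!: exI[of _ "A \<inter> B"])
qed

lemma rv_sets_measurable:
  assumes "rv_sets M X \<subseteq> sets M"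
  shows "X \<in> borel_measurable M"
  by (rule measurableI) (use assms in \<open>auto simp: rv_sets_def\<close>)

text \<open>The pairing lemma is used twice, first to separate \<open>X\<close> from
  \<open>Y\<close>, then \<open>Z\<close> from the pair. \<open>Z\<close> stands first because it
  takes the role of \<open>\<Sigma>\<close>, the outer variable of integration.\<close>

lemma (in prob_space) distr_triple_of_indep_sets:
  fixes X :: "'a \<Rightarrow> 'b::second_countable_topology" and Y :: "'a \<Rightarrow> 'c::second_countable_topology"
    and Z :: "'a \<Rightarrow> 'd::second_countable_topology"
  assumes indep: "indep_sets ((!) [rv_sets M X, rv_sets M Y, rv_sets M Z, E]) {..<4}"
  shows "distr M (borel \<Otimes>\<^sub>M (borel \<Otimes>\<^sub>M borel)) (\<lambda>\<omega>. (Z \<omega>, (X \<omega>, Y \<omega>))) =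
    distr M borel Z \<Otimes>\<^sub>M (distr M borel X \<Otimes>\<^sub>M distr M borel Y)"
proof -
  let ?F = "(!) [rv_sets M X, rv_sets M Y, rv_sets M Z, E]"
  have F: "?F 0 = rv_sets M X" "?F 1 = rv_sets M Y" "?F 2 = rv_sets M Z"
    by (simp_all add: numeral_2_eq_2)
  have ev: "?F i \<subseteq> events" if "i < 4" for i
    using indep that unfolding indep_sets_def by auto
  have [measurable]: "X \<in> borel_measurable M" "Y \<in> borel_measurable M" "Z \<in> borel_measurable M"
    using ev[of 0] ev[of 1] ev[of 2] by (auto intro!: rv_sets_measurable simp: F simp del: nth_Cons_numeral)
  have sig: "{V -` A \<inter> space M | A. A \<in> sets borel} \<subseteq> sigma_sets (space M) (rv_sets M V)"
    for V :: "'a \<Rightarrow> 'v::topological_space"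
    by (auto simp: rv_sets_def)
  have 1: "distr M (borel \<Otimes>\<^sub>M borel) (\<lambda>\<omega>. (X \<omega>, Y \<omega>)) = distr M borel X \<Otimes>\<^sub>M distr M borel Y"
    by (rule distr_pair_of_indep_sets[OF indep, of 0 "{1}"])
      (use sig[of X] sig[of Y] in \<open>auto simp: F Int_stable_rv_sets\<close>)
  let ?E = "rv_sets M X \<union> rv_sets M Y"
  have Esub: "?E \<subseteq> Pow (space M)" by (auto simp: rv_sets_def)
  \<comment> \<open>Both components are measurable for the sigma-algebra generated by
    \<open>?E\<close>, hence so is the pair.\<close>
  have sub: "{(\<lambda>\<omega>. (X \<omega>, Y \<omega>)) -` A \<inter> space M | A. A \<in> sets (borel \<Otimes>\<^sub>M borel)} \<subseteq> sigma_sets (space M) ?E"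
  proof -
    have "X \<in> borel_measurable (sigma (space M) ?E)" "Y \<in> borel_measurable (sigma (space M) ?E)"
      using Esub by (auto intro!: rv_sets_measurable simp: sets_measure_of space_measure_of rv_sets_def)
    then have "(\<lambda>\<omega>. (X \<omega>, Y \<omega>)) \<in> measurable (sigma (space M) ?E) (borel \<Otimes>\<^sub>M borel)"
      by simp
    from measurable_sets[OF this] show ?thesis
      using Esub by (auto simp: sets_measure_of space_measure_of)
  qed
  show ?thesis
    unfolding 1[symmetric]
    by (rule distr_pair_of_indep_sets[OF indep, of 2 "{0, 1}"])
      (use sub sig[of Z] in \<open>auto simp: F Int_stable_rv_sets\<close>)
qed

text \<open>Transposing \<open>y\<close> and multiplying by \<open>[V1 V2]\<close> are both
  isometries. The transposition gives \<open>y\<close> the shape of \<open>Y\<close>.\<close>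

lemma distr_gaussian_row_blocks:
  fixes V1 :: "real ^ 'a ^ 'n" and V2 :: "real ^ 'b ^ 'n"
  assumes V: "block_orthogonal V1 V2"
  shows "distr gaussian borel (\<lambda>(y, w). V1 ** transpose (y :: real ^ 'a ^ 'c) + V2 ** w) = gaussian"
proof (rule distr_gaussian_isometry)
  let ?T = "\<lambda>(X, w). V1 ** (X :: real ^ 'c ^ 'a) + V2 ** w"
  have eq: "(\<lambda>(y, w). V1 ** transpose (y :: real ^ 'a ^ 'c) + V2 ** w) = ?T \<circ> map_prod transpose id"
    by (auto simp: fun_eq_iff)
  have lin: "linear (map_prod transpose id :: (real ^ 'a ^ 'c) \<times> (real ^ 'c ^ 'b) \<Rightarrow> _)"
    by (auto intro!: linearI simp: transpose_def vec_eq_iff)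
  show "linear (\<lambda>(y, w). V1 ** transpose (y :: real ^ 'a ^ 'c) + V2 ** w)"
    unfolding eq by (rule linear_compose[OF lin block_orthogonal_isometry(1)[OF V]])
  show "norm ((\<lambda>(y, w). V1 ** transpose (y :: real ^ 'a ^ 'c) + V2 ** w) z) = norm z" for z
    unfolding eq comp_def block_orthogonal_isometry(2)[OF V] by (cases z) (simp add: norm_Pair norm_transpose)
  have "surj (transpose :: real ^ 'a ^ 'c \<Rightarrow> _)" by (rule surjI[of _ transpose]) (rule transpose_transpose)
  then have "surj (map_prod transpose id :: (real ^ 'a ^ 'c) \<times> (real ^ 'c ^ 'b) \<Rightarrow> _)"
    by (simp add: map_prod_surj)
  then show "surj (\<lambda>(y, w). V1 ** transpose (y :: real ^ 'a ^ 'c) + V2 ** w)"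
    unfolding eq using block_orthogonal_isometry(3)[OF V] by (rule comp_surj)
qed

text \<open>The block isometry is conjugated by transposition, so that the rotation acts on columns.
  It is applied at fixed \<open>y\<close>, with \<open>U1\<close> and \<open>U2\<close> depending on
  \<open>y\<close>.\<close>

lemma distr_gaussian_column_blocks:
  fixes U1 :: "real ^ 'a ^ 'n" and U2 :: "real ^ 'b ^ 'n"
  assumes U: "block_orthogonal U1 U2"
  shows "distr gaussian borel (\<lambda>(x, w). (x :: real ^ 'a ^ 'c) ** transpose U1 + w ** transpose U2) = gaussian"
proof (rule distr_gaussian_isometry)
  let ?T = "\<lambda>(X, w). U1 ** (X :: real ^ 'c ^ 'a) + U2 ** w"
  have eq: "(\<lambda>(x, w). (x :: real ^ 'a ^ 'c) ** transpose U1 + w ** transpose U2) =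
      transpose \<circ> (?T \<circ> map_prod transpose transpose)"
    by (auto simp: fun_eq_iff transpose_def matrix_matrix_mult_def vec_eq_iff mult.commute)
  have lin: "linear (map_prod transpose transpose :: (real ^ 'a ^ 'c) \<times> (real ^ 'b ^ 'c) \<Rightarrow> _)"
    "linear (transpose :: real ^ 'c ^ 'n \<Rightarrow> _)"
    by (auto intro!: linearI simp: transpose_def vec_eq_iff)
  show "linear (\<lambda>(x, w). (x :: real ^ 'a ^ 'c) ** transpose U1 + w ** transpose U2)"
    unfolding eq by (intro linear_compose lin block_orthogonal_isometry(1)[OF U])
  show "norm ((\<lambda>(x, w). (x :: real ^ 'a ^ 'c) ** transpose U1 + w ** transpose U2) z) = norm z" for z
    unfolding eq comp_def norm_transpose block_orthogonal_isometry(2)[OF U]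
    by (cases z) (simp add: norm_Pair norm_transpose)
  have su: "surj (transpose :: real ^ 'i ^ 'j \<Rightarrow> _)"
    by (rule surjI[of _ transpose]) (rule transpose_transpose)
  then have "surj (map_prod transpose transpose :: (real ^ 'a ^ 'c) \<times> (real ^ 'b ^ 'c) \<Rightarrow> _)"
    by (intro map_prod_surj surjI[of _ transpose] transpose_transpose)
  then show "surj (\<lambda>(x, w). (x :: real ^ 'a ^ 'c) ** transpose U1 + w ** transpose U2)"
    unfolding eq by (intro comp_surj block_orthogonal_isometry(3)[OF U] surjI[of transpose transpose] transpose_transpose)
qed

section \<open>The deviation bound\<close>

text \<open>The reduction from \<open>A\<close> to \<open>B\<close> is combined with the bound in
  block coordinates, taken with constant \<open>\<tau> ^ (2 * q + 1)\<close>; comparing powers then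
  yields the exponent \<open>1 / (2 * q + 1)\<close>.\<close>

lemma power_residual_le:
  fixes A :: "real ^ 'n ^ 'm" and V1 :: "real ^ 'k ^ 'n" and V2 :: "real ^ 'r ^ 'n"
    and U1 :: "real ^ 'k ^ 'd" and U2 :: "real ^ 'p ^ 'd" and R S :: "real ^ 'k ^ 'k"
  assumes V: "block_orthogonal V1 V2" and U: "block_orthogonal U1 U2"
    and B: "\<And>b. norm ((mat_power (A ** transpose A) q ** A) *v (V2 *v b)) \<le> \<tau> ^ (2 * q + 1) * norm b"
    and \<tau>: "0 \<le> \<tau>"
    and R: "R ** transpose R = mat 1" and S: "S ** matrix_inv S = mat 1" "diagonal_matrix S"
    and y: "transpose y ** U1 = R ** S" "transpose y ** U2 = 0"
  shows "spectral_norm (residual (mat_power (A ** transpose A) q ** A **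
      (V1 ** transpose y + V2 ** (x1 ** transpose U1 + x2 ** transpose U2))) ** A)
    \<le> \<tau> * diag_bound x1 x2 S powr (1 / (2 * real q + 1))"
proof -
  define N where "N = 2 * q + 1"
  define B where "B = mat_power (A ** transpose A) q ** A"
  define F where "F = V1 ** transpose y + V2 ** (x1 ** transpose U1 + x2 ** transpose U2)"
  define D where "D = diag_bound x1 x2 S"
  have D0: "0 \<le> D" by (simp add: D_def diag_bound_def spectral_norm_nonneg)
  have "spectral_norm (residual (B ** F) ** A) ^ N \<le> spectral_norm (proj_residual B F)"
    unfolding proj_residual_def B_def N_def by (rule residual_power_le)
  also have "\<dots> \<le> \<tau> ^ N * D"
    unfolding F_def D_def spectral_norm_eq_diag_bound[OF S(2), symmetric]
    by (rule spectral_norm_proj_residual_le[OF V U _ R S(1) y]) (use B in \<open>simp add: B_def N_def\<close>)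
  \<comment> \<open>\<open>D = 0\<close> is treated separately because turning powers into
    \<open>powr\<close> requires a positive base.\<close>
  also have "\<dots> = (\<tau> * D powr (1 / (2 * real q + 1))) ^ N"
    using D0 by (cases "D = 0")
      (simp_all add: N_def power_mult_distrib powr_realpow[symmetric] powr_powr add.commute del: power_Suc)
  finally show ?thesis
    unfolding B_def F_def D_def[symmetric] N_def Suc_eq_plus1[symmetric]
    by (rule power_le_imp_le_base) (simp add: \<tau>)
qed

lemma emeasure_pair_gaussian:
  "X \<in> sets (N \<Otimes>\<^sub>M gaussian) \<Longrightarrow>
   emeasure (N \<Otimes>\<^sub>M gaussian) X = (\<integral>\<^sup>+x. emeasure gaussian (Pair x -` X) \<partial>N)"
  by (rule sigma_finite_measure.emeasure_pair_measure_alt[OF prob_space_imp_sigma_finite[OF prob_space_gaussian]])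

lemma borel_measurable_emeasure_gaussian:
  "X \<in> sets (N \<Otimes>\<^sub>M gaussian) \<Longrightarrow> (\<lambda>x. emeasure gaussian (Pair x -` X)) \<in> borel_measurable N"
  by (rule sigma_finite_measure.measurable_emeasure_Pair[OF prob_space_imp_sigma_finite[OF prob_space_gaussian]])

theorem corollary1p5:
  fixes M :: "'w measure"
    and A :: "real ^ 'n ^ 'm"
    and \<sigma> :: "nat \<Rightarrow> real"
    and q :: nat
    and G :: "'w \<Rightarrow> real ^ ('k::finite + 'p::finite) ^ 'n"
    and H :: "'w \<Rightarrow> real ^ ('k + 'p) ^ 'm"
    and Q :: "'w \<Rightarrow> (real ^ 'm) set"
    and X1 :: "'w \<Rightarrow> real ^ 'k ^ 'r"
    and X2 :: "'w \<Rightarrow> real ^ 'p ^ 'r"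
    and Y :: "'w \<Rightarrow> real ^ 'k ^ ('k + 'p)"
    and \<Sigma> :: "'w \<Rightarrow> real ^ 'k ^ 'k"
    and W :: "'w \<Rightarrow> real"
  assumes "prob_space M"
    and "CARD('m) \<ge> CARD('n)"
    and "CARD('k) + CARD('p) \<le> CARD('n)"
    and "CARD('r) = CARD('n) - CARD('k)"
    and "has_singular_values A {1..CARD('n)} \<sigma>"
    and "antimono_on {1..CARD('n)} \<sigma>"
    and "iid_std_normal M G"
    and "\<And>\<omega>. \<omega> \<in> space M \<Longrightarrow> H \<omega> = mat_power (A ** transpose A) q ** A ** G \<omega>"
    and "\<And>\<omega>. \<omega> \<in> space M \<Longrightarrow> orthonormal_basis (Q \<omega>) (mat_range (H \<omega>))"
    and "iid_std_normal M X1"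
    and "iid_std_normal M X2"
    and "iid_std_normal M Y"
    and "\<And>\<omega>. \<omega> \<in> space M \<Longrightarrow> diagonal_matrix (\<Sigma> \<omega>)"
    and "\<And>\<omega>. \<omega> \<in> space M \<Longrightarrow> has_singular_values (Y \<omega>) UNIV (\<lambda>i. \<Sigma> \<omega> $ i $ i)"
    and "prob_space.indep_sets M
           ((!) [rv_sets M X1, rv_sets M X2, rv_sets M \<Sigma>, rv_sets M G]) {..<4}"
    and "\<And>\<omega>. \<omega> \<in> space M \<Longrightarrow>
           W \<omega> = spectral_norm (proj_residual (mat 1) (X2 \<omega>) **
                                hcat (X1 \<omega> ** matrix_inv (\<Sigma> \<omega>)) (mat 1))"
  shows "stoch_le M
           (\<lambda>\<omega>. spectral_norm ((mat 1 - gram_outer (Q \<omega>)) ** A))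
           (\<lambda>\<omega>. \<sigma> (CARD('k) + 1) * W \<omega> powr (1 / (2 * real q + 1)))"
proof -
  interpret prob_space M by fact
  have card: "CARD('k) + CARD('r) = CARD('n)" "CARD('k) < CARD('n)"
    using assms(3,4) zero_less_card_finite[where 'a = 'p] by linarith+
  have card_kp: "CARD('k) + CARD('p) = CARD('k + 'p)" by simp
  define \<tau> where "\<tau> = \<sigma> (CARD('k) + 1)"
  have \<tau>: "0 \<le> \<tau>"
    using assms(5) card(2) by (auto simp: has_singular_values_def \<tau>_def)
  obtain V1 :: "real ^ 'k ^ 'n" and V2 :: "real ^ 'r ^ 'n" where V: "block_orthogonal V1 V2"
    and V2: "\<And>q b. norm ((mat_power (A ** transpose A) q ** A) *v (V2 *v b)) \<le> \<tau> ^ (2 * q + 1) * norm b"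
    unfolding \<tau>_def using singular_frame_exists[OF assms(5,6) card(1)] by metis
  \<comment> \<open>Both sides of the claim become fixed Borel functions, \<open>\<Psi>\<close> of
    \<open>G\<close> and \<open>\<Phi>\<close> of \<open>\<Sigma>\<close>, \<open>X1\<close>,
    \<open>X2\<close>, so that the comparison concerns laws only.\<close>
  define \<Psi> :: "real ^ ('k + 'p) ^ 'n \<Rightarrow> real"
    where "\<Psi> g = spectral_norm (residual (mat_power (A ** transpose A) q ** A ** g) ** A)" for g
  define \<Phi> :: "(real ^ 'k ^ 'k) \<times> (real ^ 'k ^ 'r) \<times> (real ^ 'p ^ 'r) \<Rightarrow> real"
    where "\<Phi> = (\<lambda>(S, x1, x2). \<tau> * diag_bound x1 x2 S powr (1 / (2 * real q + 1)))"
  \<comment> \<open>\<open>T\<close> rebuilds \<open>G\<close> from the coordinates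
    \<open>y = transpose (transpose V1 ** G)\<close> and
    \<open>w = transpose V2 ** G\<close>.\<close>
  define T where "T = (\<lambda>(y, w). V1 ** transpose (y :: real ^ 'k ^ ('k + 'p)) + V2 ** w)"
  have \<Psi>_meas [measurable]: "\<Psi> \<in> borel_measurable borel"
    unfolding \<Psi>_def by measurable
  have \<Phi>_meas [measurable]: "\<Phi> \<in> borel_measurable (borel \<Otimes>\<^sub>M (borel \<Otimes>\<^sub>M borel))"
    unfolding \<Phi>_def by measurable
  have T_meas [measurable]: "T \<in> borel_measurable (borel \<Otimes>\<^sub>M borel)"
    unfolding T_def by measurable
  \<comment> \<open>Measurability of \<open>\<Sigma>\<close> comes from the independence hypothesis,
    whose family with index 2 consists of events.\<close>
  have sub: "rv_sets M \<Sigma> \<subseteq> events"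
    using assms(15)[unfolded indep_sets_def, THEN conjunct1, THEN bspec, of 2] by simp
  have [measurable]: "G \<in> borel_measurable M" "X1 \<in> borel_measurable M" "X2 \<in> borel_measurable M"
    "Y \<in> borel_measurable M" "\<Sigma> \<in> borel_measurable M"
    by (rule iid_std_normal_measurable rv_sets_measurable assms sub)+
  have L: "spectral_norm ((mat 1 - gram_outer (Q \<omega>)) ** A) = \<Psi> (G \<omega>)" if "\<omega> \<in> space M" for \<omega>
    using gram_outer_eq_orth_projector[OF assms(9)[OF that]] assms(8)[OF that] by (simp add: \<Psi>_def)
  have U: "\<sigma> (CARD('k) + 1) * W \<omega> powr (1 / (2 * real q + 1)) = \<Phi> (\<Sigma> \<omega>, X1 \<omega>, X2 \<omega>)" if "\<omega> \<in> space M" for \<omega>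
    by (simp only: assms(16)[OF that] spectral_norm_eq_diag_bound[OF assms(13)[OF that]] \<Phi>_def \<tau>_def case_prod_conv)
  have le: "emeasure M {\<omega>\<in>space M. t \<le> \<Psi> (G \<omega>)} \<le> emeasure M {\<omega>\<in>space M. t \<le> \<Phi> (\<Sigma> \<omega>, X1 \<omega>, X2 \<omega>)}" for t
  proof -
    define K where "K = {g. t \<le> \<Psi> g}"
    define D where "D = {z. t \<le> \<Phi> z}"
    have [measurable]: "K \<in> sets borel" unfolding K_def by measurable
    have [measurable]: "D \<in> sets (borel \<Otimes>\<^sub>M (borel \<Otimes>\<^sub>M borel))"
      using measurable_sets[OF \<Phi>_meas, of "{t..}"] by (simp add: D_def vimage_def space_pair_measure)
    have [measurable]: "T -` K \<in> sets (borel \<Otimes>\<^sub>M borel)"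
      using measurable_sets[OF T_meas, of K] by (simp add: space_pair_measure)
    have "emeasure M {\<omega>\<in>space M. t \<le> \<Psi> (G \<omega>)} = emeasure (distr M borel G) K"
      by (subst emeasure_distr) (auto simp: K_def intro!: arg_cong[of _ _ "emeasure M"])
    also have "\<dots> = emeasure (distr (gaussian \<Otimes>\<^sub>M gaussian) borel T) K"
      unfolding iid_std_normal_distr[OF assms(1,7)] T_def
      by (simp only: distr_gaussian_row_blocks[OF V] gaussian_prod[symmetric])
    also have "\<dots> = emeasure (gaussian \<Otimes>\<^sub>M gaussian) (T -` K)"
      by (subst emeasure_distr) (auto simp: space_pair_measure)
    also have "\<dots> = (\<integral>\<^sup>+y. emeasure gaussian (Pair y -` T -` K) \<partial>gaussian)"
      by (rule emeasure_pair_gaussian) measurable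
    \<comment> \<open>The integral depends only on the law of \<open>y\<close>, which is that of
      \<open>Y\<close>. Passing to \<open>Y \<omega>\<close> makes \<open>\<Sigma> \<omega>\<close>
      hold the singular values of the very matrix that is integrated over.\<close>
    also have "\<dots> = (\<integral>\<^sup>+y. emeasure gaussian (Pair y -` T -` K) \<partial>distr M borel Y)"
      unfolding iid_std_normal_distr[OF assms(1,12)] ..
    also have "\<dots> = (\<integral>\<^sup>+\<omega>. emeasure gaussian (Pair (Y \<omega>) -` T -` K) \<partial>M)"
      by (rule nn_integral_distr, measurable, rule borel_measurable_emeasure_gaussian)
        (simp cong: sets_pair_measure_cong)
    also have "\<dots> \<le> (\<integral>\<^sup>+\<omega>. emeasure (gaussian \<Otimes>\<^sub>M gaussian) (Pair (\<Sigma> \<omega>) -` D) \<partial>M)"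
    proof (rule nn_integral_mono_AE)
      have "AE y in distr M borel Y. \<forall>x. y *v x = 0 \<longrightarrow> x = 0"
        unfolding iid_std_normal_distr[OF assms(1,12)] by (rule AE_gaussian_injective) simp
      then have "AE \<omega> in M. \<forall>x. Y \<omega> *v x = 0 \<longrightarrow> x = 0"
        by (rule AE_distrD[rotated]) measurable
      then show "AE \<omega> in M. emeasure gaussian (Pair (Y \<omega>) -` T -` K) \<le>
          emeasure (gaussian \<Otimes>\<^sub>M gaussian) (Pair (\<Sigma> \<omega>) -` D)"
      proof (rule AE_mp, intro AE_I2 impI)
        fix \<omega> assume \<omega>: "\<omega> \<in> space M" and inj: "\<forall>x. Y \<omega> *v x = 0 \<longrightarrow> x = 0"
        \<comment> \<open>The decomposition is chosen at one fixed \<open>\<omega>\<close>: only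
          measures of slices are compared, so no measurable dependence on \<open>\<omega>\<close>
          enters.\<close>
        obtain U1 :: "real ^ 'k ^ ('k + 'p)" and U2 :: "real ^ 'p ^ ('k + 'p)" and R :: "real ^ 'k ^ 'k"
          where U: "block_orthogonal U1 U2" and R: "R ** transpose R = mat 1"
            and S: "\<Sigma> \<omega> ** matrix_inv (\<Sigma> \<omega>) = mat 1"
            and y: "transpose (Y \<omega>) ** U1 = R ** \<Sigma> \<omega>" "transpose (Y \<omega>) ** U2 = 0"
          using singular_decomposition_exists[OF assms(14)[OF \<omega>] assms(13)[OF \<omega>] _ card_kp] inj by metis
        let ?U = "\<lambda>(x1 :: real ^ 'k ^ 'r, x2 :: real ^ 'p ^ 'r). x1 ** transpose U1 + x2 ** transpose U2"
        have Um [measurable]: "?U \<in> borel_measurable (borel \<Otimes>\<^sub>M borel)" by measurable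
        have Km [measurable]: "Pair (Y \<omega>) -` T -` K \<in> sets borel"
          using sets_Pair1[of "T -` K" borel borel "Y \<omega>"] by simp
        \<comment> \<open>In the slice \<open>w\<close> is Gaussian, and rotating its columns writes
          it through independent Gaussian blocks \<open>x1\<close> and \<open>x2\<close>, for which
          the deterministic bound holds pointwise.\<close>
        have "emeasure gaussian (Pair (Y \<omega>) -` T -` K) =
            emeasure (distr (gaussian \<Otimes>\<^sub>M gaussian) borel ?U) (Pair (Y \<omega>) -` T -` K)"
          by (simp only: distr_gaussian_column_blocks[OF U] gaussian_prod[symmetric])
        also have "\<dots> = emeasure (gaussian \<Otimes>\<^sub>M gaussian) (?U -` Pair (Y \<omega>) -` T -` K)"
          by (subst emeasure_distr) (simp_all add: space_pair_measure)
        also have "\<dots> \<le> emeasure (gaussian \<Otimes>\<^sub>M gaussian) (Pair (\<Sigma> \<omega>) -` D)"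
        proof (rule emeasure_mono)
          show "?U -` Pair (Y \<omega>) -` T -` K \<subseteq> Pair (\<Sigma> \<omega>) -` D"
          proof (clarsimp simp: K_def D_def)
            fix x1 x2 assume "t \<le> \<Psi> (T (Y \<omega>, x1 ** transpose U1 + x2 ** transpose U2))"
            also have "\<dots> \<le> \<Phi> (\<Sigma> \<omega>, x1, x2)"
              using power_residual_le[OF V U V2 \<tau> R S assms(13)[OF \<omega>] y]
              by (simp add: \<Psi>_def T_def \<Phi>_def)
            finally show "t \<le> \<Phi> (\<Sigma> \<omega>, x1, x2)" .
          qed
          have "Pair (\<Sigma> \<omega>) -` D \<in> sets (borel \<Otimes>\<^sub>M borel)" by (rule sets_Pair1) measurable
          then show "Pair (\<Sigma> \<omega>) -` D \<in> sets (gaussian \<Otimes>\<^sub>M gaussian)"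
            by (simp cong: sets_pair_measure_cong)
        qed
        finally show "emeasure gaussian (Pair (Y \<omega>) -` T -` K) \<le>
          emeasure (gaussian \<Otimes>\<^sub>M gaussian) (Pair (\<Sigma> \<omega>) -` D)" .
      qed
    qed
    \<comment> \<open>The bound depends on \<open>\<omega>\<close> only through
      \<open>\<Sigma> \<omega>\<close>.\<close>
    also have "\<dots> = (\<integral>\<^sup>+S. emeasure (gaussian \<Otimes>\<^sub>M gaussian) (Pair S -` D) \<partial>distr M borel \<Sigma>)"
      unfolding gaussian_prod[symmetric]
      by (rule nn_integral_distr[symmetric], measurable, rule borel_measurable_emeasure_gaussian)
        (simp add: gaussian_prod cong: sets_pair_measure_cong)
    also have "\<dots> = emeasure (distr M borel \<Sigma> \<Otimes>\<^sub>M (gaussian \<Otimes>\<^sub>M gaussian)) D"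
      unfolding gaussian_prod[symmetric]
      by (rule emeasure_pair_gaussian[symmetric]) (simp add: gaussian_prod cong: sets_pair_measure_cong)
    \<comment> \<open>Independence of \<open>\<Sigma>\<close>, \<open>X1\<close> and
      \<open>X2\<close> identifies the product of the three laws with their joint law.\<close>
    also have "distr M borel \<Sigma> \<Otimes>\<^sub>M (gaussian \<Otimes>\<^sub>M gaussian) =
        distr M (borel \<Otimes>\<^sub>M (borel \<Otimes>\<^sub>M borel)) (\<lambda>\<omega>. (\<Sigma> \<omega>, (X1 \<omega>, X2 \<omega>)))"
      unfolding distr_triple_of_indep_sets[OF assms(15)]
        iid_std_normal_distr[OF assms(1,10)] iid_std_normal_distr[OF assms(1,11)] ..
    also have "emeasure \<dots> D = emeasure M ((\<lambda>\<omega>. (\<Sigma> \<omega>, (X1 \<omega>, X2 \<omega>))) -` D \<inter> space M)"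
      by (rule emeasure_distr) measurable
    also have "(\<lambda>\<omega>. (\<Sigma> \<omega>, (X1 \<omega>, X2 \<omega>))) -` D \<inter> space M = {\<omega>\<in>space M. t \<le> \<Phi> (\<Sigma> \<omega>, X1 \<omega>, X2 \<omega>)}"
      by (auto simp: D_def)
    finally show ?thesis .
  qed

  show ?thesis
    unfolding stoch_le_def
  proof (intro conjI allI)
    show "(\<lambda>\<omega>. spectral_norm ((mat 1 - gram_outer (Q \<omega>)) ** A)) \<in> borel_measurable M"
      by (subst measurable_cong[OF L]) measurable
    show "(\<lambda>\<omega>. \<sigma> (CARD('k) + 1) * W \<omega> powr (1 / (2 * real q + 1))) \<in> borel_measurable M"
      by (subst measurable_cong[OF U]) measurable
    show "measure M {\<omega>\<in>space M. spectral_norm ((mat 1 - gram_outer (Q \<omega>)) ** A) \<ge> t} \<le>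
        measure M {\<omega>\<in>space M. \<sigma> (CARD('k) + 1) * W \<omega> powr (1 / (2 * real q + 1)) \<ge> t}" for t
    proof -
      have "{\<omega>\<in>space M. spectral_norm ((mat 1 - gram_outer (Q \<omega>)) ** A) \<ge> t} = {\<omega>\<in>space M. t \<le> \<Psi> (G \<omega>)}"
        by (intro Collect_cong conj_cong refl) (simp only: L)
      moreover have "{\<omega>\<in>space M. \<sigma> (CARD('k) + 1) * W \<omega> powr (1 / (2 * real q + 1)) \<ge> t} =
          {\<omega>\<in>space M. t \<le> \<Phi> (\<Sigma> \<omega>, X1 \<omega>, X2 \<omega>)}"
        by (intro Collect_cong conj_cong refl) (simp only: U)
      ultimately show ?thesis
        using le[of t] by (simp only: emeasure_eq_measure ennreal_le_iff measure_nonneg)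
    qed
  qed
qed

end
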